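(* Let $0<q<1$, $n\in\mathbb{Z}_{\ge 0}$, $\theta\in\mathbb{C}$, and let $a,s,t$ be nonzero complex numbers. Then, with $r_n$ denoting the normalized Askey-Wilson polynomial, \begin{align*} &r_n\bigl(\cos\theta;\,ast^{-1}q^{1/2},\,ats^{-1}q^{1/2},\,-astq^{1/2},\,-as^{-1}t^{-1}q^{1/2}\mid q\bigr) =(-1)^n a^{2n} q^{\frac12 n(n+1)}(1+a^2)\\ &\quad\times\sum_{k=0}^n \frac{(1-a^2q^k)\,(q^{-n},a^4q,a^4q^{n+1};q)_k\,(a^{-2}st^{-1}q^{1/2})^k} {(1-a^4q^k)\,(q;q)_k\,(a^2q;q)_k^2\,(-a^2s^2q;q)_k\,(-a^2t^{-2}q;q)_k}\\ &\quad\times {}_2\phi_2\!\left(\begin{matrix}q^{-n+k},\,a^4q^{n+k+1}\\ a^2q^{k+1},\,-a^2s^2q^{k+1}\end{matrix};q,-s^2q\right) {}_2\phi_2\!\left(\begin{matrix}q^{-n+k},\,a^4q^{n+k+1}\\ a^2q^{k+1},\,-a^2t^{-2}q^{k+1}\end{matrix};q,-t^{-2}q\right)\\ &\quad\times r_k\bigl(\cos\theta;\,a,-a,aq^{1/2},-aq^{1/2}\mid q\bigr), \end{align*} or, in terms of the Askey-Wilson polynomials $p_n$, \begin{align*} &p_n\bigl(\cos\theta;\,ast^{-1}q^{1/2},\,ats^{-1}q^{1/2},\,-astq^{1/2},\,-as^{-1}t^{-1}q^{1/2}\mid q\bigr)\\ &=(-1)^nq^{\frac12 n^2}\sum_{k=0}^n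 a^{n-k}\,(a^2q^{k+1};q)_{n-k}\; q^{\frac12 k}\,\frac{(q^{-n},a^4q^{n+1};q)_k}{(q,a^4q^k;q)_k}\; \frac{(-a^2s^2q^{k+1},-a^2t^{-2}q^{k+1};q)_{n-k}}{(st^{-1})^{n-k}}\\ &\quad\times {}_2\phi_2\!\left(\begin{matrix}q^{-n+k},\,a^4q^{n+k+1}\\ a^2q^{k+1},\,-a^2s^2q^{k+1}\end{matrix};q,-s^2q\right) {}_2\phi_2\!\left(\begin{matrix}q^{-n+k},\,a^4q^{n+k+1}\\ a^2q^{k+1},\,-a^2t^{-2}q^{k+1}\end{matrix};q,-t^{-2}q\right)\\ &\quad\times p_k\bigl(\cos\theta;\,a,-a,aq^{1/2},-aq^{1/2}\mid q\bigr). \end{align*} Each of the two identities is asserted for all parameter values for which no denominator occurring in it (including those in the defining series of $r_n$, $r_k$, $p_n$, $p_k$ and of the ${}_2\phi_2$'s) vanishes.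
   Context: Throughout $0<q<1$, and $q^{1/2}$ is the positive square root. $q$-shifted factorials: for $k\in\mathbb{Z}_{\ge0}$, $(x;q)_k:=\prod_{j=0}^{k-1}(1-xq^j)$, with $(x;q)_0=1$, and $(x_1,\dots,x_r;q)_k:=\prod_{i=1}^r (x_i;q)_k$. Basic hypergeometric series: $${}_4\phi_3\!\left(\begin{matrix}a_1,a_2,a_3,a_4\\ b_1,b_2,b_3\end{matrix};q,z\right):=\sum_{j\ge0}\frac{(a_1,a_2,a_3,a_4;q)_j}{(b_1,b_2,b_3,q;q)_j}\,z^j,$$ $${}_2\phi_2\!\left(\begin{matrix}a_1,a_2\\ b_1,b_2\end{matrix};q,z\right):=\sum_{j\ge0}\frac{(a_1,a_2;q)_j}{(b_1,b_2,q;q)_j}\,(-1)^jq^{\frac12 j(j-1)}\,z^j.$$ When an upper parameter is $q^{-N}$ with $N\in\mathbb{Z}_{\ge0}$, the series terminates: it is the sum over $0\le j\le N$. Askey-Wilson polynomials: for $n\in\mathbb{Z}_{\ge0}$, $$r_n(\cos\theta;a,b,c,d\mid q):={}_4\phi_3\!\left(\begin{matrix}q^{-n},\,abcdq^{n-1},\,ae^{i\theta},\,ae^{-i\theta}\\ ab,\,ac,\,ad\end{matrix};q,q\right),$$ $$p_n(\cos\theta;a,b,c,d\mid q):=a^{-n}(ab,ac,ad;q)_n\,r_n(\cos\theta;a,b,c,d\mid q).$$ *)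

theory Defs
  imports "HOL-Analysis.Analysis"
begin

definition qpoch :: "complex \<Rightarrow> real \<Rightarrow> nat \<Rightarrow> complex" where
  "qpoch x q k = (\<Prod>j<k. 1 - x * of_real q ^ j)"

definition qpochs :: "complex list \<Rightarrow> real \<Rightarrow> nat \<Rightarrow> complex" where
  "qpochs xs q k = (\<Prod>x\<leftarrow>xs. qpoch x q k)"

text \<open>If an upper parameter is \<open>q\<close> to the power \<open>-N\<close>, the numerators vanish for \<open>j > N\<close>, so the
  infinite sums below reduce to sums over \<open>j \<le> N\<close>, whatever the denominators do for \<open>j > N\<close>
  (recall \<open>0 / 0 = 0\<close>); see \<open>phi43_terminates\<close> and \<open>phi22_terminates\<close>.\<close>

definition phi43 :: "complex \<Rightarrow> complex \<Rightarrow> complex \<Rightarrow> complex \<Rightarrow>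
    complex \<Rightarrow> complex \<Rightarrow> complex \<Rightarrow> real \<Rightarrow> complex \<Rightarrow> complex" where
  "phi43 a1 a2 a3 a4 b1 b2 b3 q z =
     (\<Sum>j. qpochs [a1, a2, a3, a4] q j / qpochs [b1, b2, b3, of_real q] q j * z ^ j)"

definition phi22 :: "complex \<Rightarrow> complex \<Rightarrow> complex \<Rightarrow> complex \<Rightarrow> real \<Rightarrow> complex \<Rightarrow> complex" where
  "phi22 a1 a2 b1 b2 q z =
     (\<Sum>j. qpochs [a1, a2] q j / qpochs [b1, b2, of_real q] q j
          * (-1) ^ j * of_real q ^ (j * (j - 1) div 2) * z ^ j)"

text \<open>The Askey-Wilson polynomials are evaluated at \<open>cos \<theta>\<close>, with the complex number \<open>\<theta>\<close> as
  argument; by \<open>aw_r_cong\<close> and \<open>aw_p_cong\<close> the values depend on \<open>\<theta>\<close> only through \<open>cos \<theta>\<close>.\<close>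

definition aw_r :: "nat \<Rightarrow> complex \<Rightarrow> complex \<Rightarrow> complex \<Rightarrow> complex \<Rightarrow> complex \<Rightarrow> real \<Rightarrow> complex" where
  "aw_r n \<theta> a b c d q =
     phi43 (of_real q powi (- int n)) (a * b * c * d * of_real q powi (int n - 1))
           (a * exp (\<i> * \<theta>)) (a * exp (- (\<i> * \<theta>)))
           (a * b) (a * c) (a * d) q (of_real q)"

definition aw_p :: "nat \<Rightarrow> complex \<Rightarrow> complex \<Rightarrow> complex \<Rightarrow> complex \<Rightarrow> complex \<Rightarrow> real \<Rightarrow> complex" where
  "aw_p n \<theta> a b c d q =
     a powi (- int n) * qpochs [a * b, a * c, a * d] q n * aw_r n \<theta> a b c d q"

text \<open>No denominator vanishes in the terminating series of \<open>aw_r n\<close> (hence of \<open>aw_p n\<close>, when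
  \<open>a \<noteq> 0\<close>), respectively in a \<open>phi22\<close> series with an upper parameter \<open>q\<close> to the power \<open>-N\<close>.\<close>

definition aw_nondeg :: "nat \<Rightarrow> complex \<Rightarrow> complex \<Rightarrow> complex \<Rightarrow> complex \<Rightarrow> real \<Rightarrow> bool" where
  "aw_nondeg n a b c d q \<longleftrightarrow> (\<forall>j\<le>n. qpochs [a * b, a * c, a * d, of_real q] q j \<noteq> 0)"

definition phi22_nondeg :: "nat \<Rightarrow> complex \<Rightarrow> complex \<Rightarrow> real \<Rightarrow> bool" where
  "phi22_nondeg N b1 b2 q \<longleftrightarrow> (\<forall>j\<le>N. qpochs [b1, b2, of_real q] q j \<noteq> 0)"

lemma qpoch_neg_power_eq_0:
  assumes "q \<noteq> 0" and "N < j"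
  shows "qpoch (of_real q powi (- int N)) q j = 0"
proof -
  have "1 - of_real q powi (- int N) * of_real q ^ N = (0 :: complex)"
    using assms by (simp add: power_int_minus)
  then show ?thesis
    using assms unfolding qpoch_def by (auto intro!: prod_zero)
qed

lemma phi43_terminates:
  assumes "q \<noteq> 0"
  shows "phi43 (of_real q powi (- int N)) a2 a3 a4 b1 b2 b3 q z =
    (\<Sum>j\<le>N. qpochs [of_real q powi (- int N), a2, a3, a4] q j
            / qpochs [b1, b2, b3, of_real q] q j * z ^ j)"
  unfolding phi43_def
  by (rule suminf_finite) (use assms in \<open>auto simp: qpochs_def qpoch_neg_power_eq_0\<close>)

lemma phi22_terminates:
  assumes "q \<noteq> 0"
  shows "phi22 (of_real q powi (- int N)) a2 b1 b2 q z =
    (\<Sum>j\<le>N. qpochs [of_real q powi (- int N), a2] q j / qpochs [b1, b2, of_real q] q j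
            * (-1) ^ j * of_real q ^ (j * (j - 1) div 2) * z ^ j)"
  unfolding phi22_def
  by (rule suminf_finite) (use assms in \<open>auto simp: qpochs_def qpoch_neg_power_eq_0\<close>)

lemma aw_r_cong:
  assumes "cos \<theta> = cos \<theta>'"
  shows "aw_r n \<theta> a b c d q = aw_r n \<theta>' a b c d q"
proof -
  have expand: "(1 - x * e * y) * (1 - x * e' * y) = 1 - x * y * (e + e') + (x * y)\<^sup>2 * (e * e')"
    for x y e e' :: complex
    by (simp add: algebra_simps power2_eq_square)
  have pair: "qpoch (x * exp (\<i> * \<phi>)) q j * qpoch (x * exp (- (\<i> * \<phi>))) q j =
      (\<Prod>i<j. 1 - 2 * x * of_real q ^ i * cos \<phi> + (x * of_real q ^ i)\<^sup>2)" for x \<phi> j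
    unfolding qpoch_def prod.distrib [symmetric]
  proof (rule prod.cong [OF refl])
    fix i
    have "exp (\<i> * \<phi>) * exp (- (\<i> * \<phi>)) = 1"
      by (simp flip: exp_add)
    moreover have "exp (\<i> * \<phi>) + exp (- (\<i> * \<phi>)) = 2 * cos \<phi>"
      by (simp add: cos_exp_eq)
    ultimately show "(1 - x * exp (\<i> * \<phi>) * of_real q ^ i) * (1 - x * exp (- (\<i> * \<phi>)) * of_real q ^ i) =
        1 - 2 * x * of_real q ^ i * cos \<phi> + (x * of_real q ^ i)\<^sup>2"
      unfolding expand by (simp add: mult_ac)
  qed
  have "qpochs [u, v, a * exp (\<i> * \<theta>), a * exp (- (\<i> * \<theta>))] q j =
      qpochs [u, v, a * exp (\<i> * \<theta>'), a * exp (- (\<i> * \<theta>'))] q j" for u v j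
    using pair [of a \<theta> j] pair [of a \<theta>' j] assms by (simp add: qpochs_def)
  then show ?thesis
    by (simp add: aw_r_def phi43_def)
qed

lemma aw_p_cong:
  assumes "cos \<theta> = cos \<theta>'"
  shows "aw_p n \<theta> a b c d q = aw_p n \<theta>' a b c d q"
  using aw_r_cong [OF assms] by (simp add: aw_p_def)

end

theory Submission
  imports Defs
begin

text \<open>Write \<open>\<beta> = a\<^sup>2\<close>, \<open>X = -s\<^sup>2\<close>, \<open>Y = -1/t\<^sup>2\<close> and \<open>w = a s q\<^sup>1\<^sup>/\<^sup>2 / t\<close>, so that \<open>w\<^sup>2 = \<beta> q X Y\<close>. On the left-hand
  side the basis functions \<open>(w e\<^sup>i\<^sup>\<theta>, w e\<^sup>-\<^sup>i\<^sup>\<theta>; q)\<^sub>j\<close> are expanded in the continuous \<open>q\<close>-ultraspherical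
  polynomials \<open>r\<^sub>k(cos \<theta>; a, -a, a q\<^sup>1\<^sup>/\<^sup>2, -a q\<^sup>1\<^sup>/\<^sup>2 | q)\<close>, by induction on \<open>j\<close> using their three-term recurrence.
  The coefficient of the \<open>k\<close>-th polynomial is then a double sum in \<open>X\<close>, \<open>Y\<close> and \<open>c = \<beta> q\<^sup>k\<^sup>+\<^sup>1\<close>, which factors by a
  \<open>q\<close>-analogue of Bailey's product formula
  \[ (-c)^m q^{m(m-1)/2}\, {}_2\phi_2(X)\, {}_2\phi_2(Y) = \sum_{i,l} \frac{(q^{-m}, c^2 q^{m-1}; q)_{i+l}\, q^{i+l} q^{i(i-1)} (cXY)^i}
     {(q, c; q)_i (q, c; q)_l (cX, cY; q)_{i+l}}, \]
  where \<open>m = n - k\<close>. It follows from re-expanding products of the \<open>(q\<^sup>-\<^sup>m, c\<^sup>2 q\<^sup>m\<^sup>-\<^sup>1; q)\<^sub>J\<close> in the same family, the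
  \<open>q\<close>-binomial theorem, and the \<open>q\<close>-Vandermonde sum.\<close>

text \<open>The induction step shared by \<open>vandermonde_sum\<close>,
  \<open>q_binomial_sum\<close> and \<open>lin_poly_Suc\<close>. Each term on the antidiagonal
  \<open>Suc m\<close> is cut in two: one part vanishes at \<open>v = 0\<close> and is shifted in
  \<open>v\<close>, the other vanishes at \<open>u = 0\<close> and is shifted in
  \<open>u\<close>.\<close>

lemma sum_antidiagonal_Suc:
  fixes f A B a b :: "nat \<Rightarrow> nat \<Rightarrow> complex"
  assumes "\<And>u v. u + v = Suc m \<Longrightarrow> f u v = a u v + b u v"
    and "a (Suc m) 0 = 0" "\<And>u v. u + v = m \<Longrightarrow> a u (Suc v) = A u v"
    and "b 0 (Suc m) = 0" "\<And>u v. u + v = m \<Longrightarrow> b (Suc u) v = B u v"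
  shows "(\<Sum>u\<le>Suc m. f u (Suc m - u)) = (\<Sum>u\<le>m. A u (m - u) + B u (m - u))"
proof -
  have "(\<Sum>u\<le>Suc m. f u (Suc m - u)) = (\<Sum>u\<le>Suc m. a u (Suc m - u)) + (\<Sum>u\<le>Suc m. b u (Suc m - u))"
    using assms(1) by (simp flip: sum.distrib)
  also have "(\<Sum>u\<le>Suc m. a u (Suc m - u)) = (\<Sum>u\<le>m. A u (m - u))"
    using assms(2,3) by (simp add: Suc_diff_le)
  also have "(\<Sum>u\<le>Suc m. b u (Suc m - u)) = (\<Sum>u\<le>m. B u (m - u))"
    using assms(4,5) by (subst sum.atMost_Suc_shift) simp
  finally show ?thesis
    by (simp add: sum.distrib)
qed

section \<open>Powers, binomial coefficients and shifted factorials\<close>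

lemma power_double: "x ^ (2 * k) = x ^ k * (x ^ k :: 'a :: monoid_mult)"
  by (simp add: mult_2 power_add)

lemma Suc_choose_2: "Suc p choose 2 = (p choose 2) + p"
  by (simp add: numeral_2_eq_2)

lemma zero_choose_2 [simp]: "0 choose 2 = (0::nat)"
  by (simp add: numeral_2_eq_2)

lemma add_choose_2: "(k + i) choose 2 = (k choose 2) + i * k + (i choose 2)"
  by (induction i) (simp_all add: Suc_choose_2)

lemma double_choose_2: "(i choose 2) + (i choose 2) = i * (i - 1)"
  by (induction i) (simp_all add: Suc_choose_2 algebra_simps)

lemma qpoch_0 [simp]: "qpoch x q 0 = 1"
  by (simp add: qpoch_def)

lemma qpoch_zero [simp]: "qpoch 0 q k = 1"
  by (simp add: qpoch_def)

lemma qpoch_Suc: "qpoch x q (Suc k) = qpoch x q k * (1 - x * of_real q ^ k)"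
  by (simp add: qpoch_def)

lemma qpoch_add: "qpoch x q (j + k) = qpoch x q j * qpoch (x * of_real q ^ j) q k"
  by (induction k) (simp_all add: qpoch_Suc power_add mult_ac)

lemma qpoch_Suc_left: "qpoch x q (Suc k) = (1 - x) * qpoch (x * of_real q) q k"
  using qpoch_add [of x q 1 k] by (simp add: qpoch_def)

lemma qpoch_nonzero_mono: "qpoch x q k \<noteq> 0 \<Longrightarrow> j \<le> k \<Longrightarrow> qpoch x q j \<noteq> 0"
  by (auto simp: qpoch_def)

lemma qpoch_zero_mono: "qpoch x q j = 0 \<Longrightarrow> j \<le> k \<Longrightarrow> qpoch x q k = 0"
  using qpoch_nonzero_mono by blast

text \<open>Comparing coefficients in \<open>ultra_recurrence\<close> comes down to this rational
  identity, with b = a^2, r = q^k, p = q^j and z = q. Free variables keep the powers out of the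
  polynomial arithmetic.\<close>

lemma ultra_coeff_identity:
  fixes b p r z :: "'a :: field"
  assumes "r \<noteq> 0" "p \<noteq> 0" "z \<noteq> 0"
  shows "(1 - b * r) * ((1 + b * (z * p)\<^sup>2) / (z * p) * ((1 - p / r) * (1 - b\<^sup>2 * r * p) * z)
        - ((1 - z * p) * (1 + b * p) * (1 - b\<^sup>2 * z * p\<^sup>2)) / p)
        + b * r * ((1 - p / r) * (1 - z * p / r) * (1 - b\<^sup>2 * r / z) * z)
      = (1 - 1 / (z * r)) * ((1 - b\<^sup>2 * r * p) * (1 - b\<^sup>2 * r * (z * p))) * z"
  using assms by (simp add: divide_simps) (simp add: algebra_simps power2_eq_square)


locale q_base =
  fixes q :: real
  assumes q_pos: "0 < q" and q_less_1: "q < 1"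
begin

abbreviation Q :: complex where "Q \<equiv> of_real q"
abbreviation poch :: "complex \<Rightarrow> nat \<Rightarrow> complex" where "poch x k \<equiv> qpoch x q k"

lemma q_nonzero [simp]: "q \<noteq> 0"
  using q_pos by simp

lemma Q_nonzero: "Q \<noteq> 0"
  using q_pos by simp

lemma Q_power_neq_1 [simp]: "Q * Q ^ k \<noteq> 1"
proof -
  have "q ^ Suc k < 1"
    using q_pos q_less_1 by (intro power_Suc_less_one) auto
  then have "Q ^ Suc k \<noteq> 1"
    by (metis less_irrefl of_real_eq_1_iff of_real_power)
  then show ?thesis by simp
qed

lemma poch_Q_nonzero [simp]: "poch Q k \<noteq> 0"
  by (simp add: qpoch_def)

subsection \<open>Terminating \<open>q\<close>-sums\<close>

text \<open>The \<open>q\<close>-Chu-Vandermonde sum multiplied through by (c;q)_m / (q;q)_m, which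
  makes it polynomial in \<open>g\<close> and \<open>c\<close>. The induction splits 1 - q^(m+1) =
  q^u (1 - q^v) + (1 - q^u) for u + v = m + 1; the first part keeps (g, c), the second replaces it
  by (g q, c q).\<close>

lemma vandermonde_sum:
  "(\<Sum>N\<le>m. (-1) ^ N * Q ^ (N choose 2) * Q ^ N / (Q ^ N) ^ m / (poch Q N * poch Q (m - N))
      * poch g N * poch (c * Q ^ N) (m - N)) = (\<Prod>r<m. g - c * Q ^ r) / poch Q m"
proof (induction m arbitrary: g c)
  case 0
  show ?case by simp
next
  case (Suc m)
  define f where "f M g c u v = (-1) ^ u * Q ^ (u choose 2) * Q ^ u / (Q ^ u) ^ M / (poch Q u * poch Q v)
      * poch g u * poch (c * Q ^ u) v" for M g c u v
  have IH: "(\<Sum>u\<le>m. f m g c u (m - u)) = (\<Prod>r<m. g - c * Q ^ r) / poch Q m" for g c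
    using Suc unfolding f_def by blast
  have "(\<Sum>u\<le>Suc m. (1 - Q ^ Suc m) * f (Suc m) g c u (Suc m - u)) =
      (\<Sum>u\<le>m. (1 - c * Q ^ m) * f m g c u (m - u) + (- (1 - g) / Q ^ m) * f m (g * Q) (c * Q) u (m - u))"
  proof (rule sum_antidiagonal_Suc [where a = "\<lambda>u v. Q ^ u * (1 - Q ^ v) * f (Suc m) g c u v"
        and b = "\<lambda>u v. (1 - Q ^ u) * f (Suc m) g c u v"])
    fix u v assume "u + v = Suc m"
    then show "(1 - Q ^ Suc m) * f (Suc m) g c u v =
        Q ^ u * (1 - Q ^ v) * f (Suc m) g c u v + (1 - Q ^ u) * f (Suc m) g c u v"
      by (simp add: algebra_simps flip: power_add power_Suc)
  next
    fix u v assume "u + v = m"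
    then have m: "m = u + v" by simp
    show "Q ^ u * (1 - Q ^ Suc v) * f (Suc m) g c u (Suc v) = (1 - c * Q ^ m) * f m g c u v"
      unfolding f_def m by (simp add: qpoch_Suc power_add divide_simps)
    show "(1 - Q ^ Suc u) * f (Suc m) g c (Suc u) v = (- (1 - g) / Q ^ m) * f m (g * Q) (c * Q) u v"
      unfolding f_def m
      by (simp add: qpoch_Suc [of Q] qpoch_Suc_left [of g] power_add power_mult_distrib Suc_choose_2 divide_simps mult_ac)
        (simp add: algebra_simps)
  qed auto
  also have "\<dots> = (1 - c * Q ^ m) * ((\<Prod>r<m. g - c * Q ^ r) / poch Q m)
      + (- (1 - g) / Q ^ m) * ((\<Prod>r<m. g * Q - c * Q * Q ^ r) / poch Q m)"
    by (simp only: IH sum.distrib sum_distrib_left [symmetric])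
  also have "(\<Prod>r<m. g * Q - c * Q * Q ^ r) = Q ^ m * (\<Prod>r<m. g - c * Q ^ r)"
  proof -
    have "(\<Prod>r<m. g * Q - c * Q * Q ^ r) = (\<Prod>r<m. Q * (g - c * Q ^ r))"
      by (rule prod.cong) (auto simp: algebra_simps)
    then show ?thesis by (simp add: prod.distrib)
  qed
  \<comment> \<open>The two parts combine because (1 - c q^m) - (1 - g) = g - c q^m is the next
    factor of the product.\<close>
  also have "(1 - c * Q ^ m) * ((\<Prod>r<m. g - c * Q ^ r) / poch Q m)
      + (- (1 - g) / Q ^ m) * (Q ^ m * (\<Prod>r<m. g - c * Q ^ r) / poch Q m) =
      (1 - Q ^ Suc m) * ((\<Prod>r<Suc m. g - c * Q ^ r) / poch Q (Suc m))"
    by (simp add: qpoch_Suc divide_simps) (simp add: algebra_simps)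
  finally have "(1 - Q ^ Suc m) * (\<Sum>u\<le>Suc m. f (Suc m) g c u (Suc m - u)) =
      (1 - Q ^ Suc m) * ((\<Prod>r<Suc m. g - c * Q ^ r) / poch Q (Suc m))"
    by (simp only: sum_distrib_left)
  then show ?case
    unfolding f_def by (simp only: mult_cancel_left) (use Q_power_neq_1 in auto)
qed

text \<open>Only the top power of \<open>v\<close> survives. The splitting 1 - q^(i+1) = (1 - q^r) +
  q^r (1 - q^p) for p + r = i + 1 leads to the sums at \<open>v * Q\<close> and at \<open>v\<close>,
  and these combine through q^i - q^i (1 - v q^i) = v q^(2i).\<close>

lemma q_binomial_sum:
  "(\<Sum>p\<le>i. (-1) ^ p * Q ^ (p choose 2) / (poch Q p * poch Q (i - p)) * poch (v * Q ^ (i - p)) p) =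
    v ^ i * Q ^ (i * (i - 1)) / poch Q i"
proof (induction i arbitrary: v)
  case 0
  show ?case by simp
next
  case (Suc i)
  define f where "f v p r = (-1) ^ p * Q ^ (p choose 2) / (poch Q p * poch Q r) * poch (v * Q ^ r) p" for v p r
  have IH: "(\<Sum>p\<le>i. f v p (i - p)) = v ^ i * Q ^ (i * (i - 1)) / poch Q i" for v
    using Suc unfolding f_def by blast
  have "(\<Sum>p\<le>Suc i. (1 - Q ^ Suc i) * f v p (Suc i - p)) =
      (\<Sum>p\<le>i. f (v * Q) p (i - p) + (- (Q ^ i) * (1 - v * Q ^ i)) * f v p (i - p))"
  proof (rule sum_antidiagonal_Suc [where a = "\<lambda>p r. (1 - Q ^ r) * f v p r"
        and b = "\<lambda>p r. Q ^ r * (1 - Q ^ p) * f v p r"])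
    fix p r assume "p + r = Suc i"
    then show "(1 - Q ^ Suc i) * f v p r = (1 - Q ^ r) * f v p r + Q ^ r * (1 - Q ^ p) * f v p r"
      by (simp add: algebra_simps flip: power_add power_Suc)
  next
    fix p r assume "p + r = i"
    then have i: "i = p + r" by simp
    show "(1 - Q ^ Suc r) * f v p (Suc r) = f (v * Q) p r"
      unfolding f_def by (simp add: qpoch_Suc divide_simps mult_ac)
    show "Q ^ r * (1 - Q ^ Suc p) * f v (Suc p) r = (- (Q ^ i) * (1 - v * Q ^ i)) * f v p r"
      unfolding f_def i by (simp add: qpoch_Suc power_add Suc_choose_2 divide_simps mult_ac)
  qed auto
  also have "\<dots> = (v * Q) ^ i * Q ^ (i * (i - 1)) / poch Q i
      + (- (Q ^ i) * (1 - v * Q ^ i)) * (v ^ i * Q ^ (i * (i - 1)) / poch Q i)"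
    by (simp only: IH sum.distrib sum_distrib_left [symmetric])
  also have "\<dots> = v ^ Suc i * (Q ^ (i * (i - 1)) * Q ^ i * Q ^ i) / poch Q i"
    by (simp add: power_mult_distrib divide_simps) (simp add: algebra_simps)
  also have "Q ^ (i * (i - 1)) * Q ^ i * Q ^ i = Q ^ (Suc i * (Suc i - 1))"
    by (cases i) (simp_all add: algebra_simps flip: power_add)
  also have "v ^ Suc i * Q ^ (Suc i * (Suc i - 1)) / poch Q i =
      (1 - Q ^ Suc i) * (v ^ Suc i * Q ^ (Suc i * (Suc i - 1)) / poch Q (Suc i))"
    by (simp add: qpoch_Suc)
  finally have "(1 - Q ^ Suc i) * (\<Sum>p\<le>Suc i. f v p (Suc i - p)) =
      (1 - Q ^ Suc i) * (v ^ Suc i * Q ^ (Suc i * (Suc i - 1)) / poch Q (Suc i))"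
    by (simp only: sum_distrib_left)
  then show ?case
    unfolding f_def by (simp only: mult_cancel_left) (use Q_power_neq_1 in auto)
qed

text \<open>Evaluates the sum over \<open>p\<close> in \<open>jackson_sum_mult\<close>. As (x;q)_J =
  (x;q)_(J-p) (x q^(J-p);q)_p, all terms get the common denominator (x;q)_J, and
  \<open>q_binomial_sum\<close> applies with v = x q^(J-i).\<close>

lemma inner_q_binomial:
  assumes X: "poch (x) J \<noteq> 0" and "i \<le> J"
  shows "(\<Sum>p\<le>i. (-1) ^ p * Q ^ (p choose 2) / (poch Q p * poch Q (i - p)) / poch (x) (J - p)) =
    (x * Q ^ (J - i)) ^ i * Q ^ (i * (i - 1)) / poch Q i / poch (x) J"
proof -
  have "(\<Sum>p\<le>i. (-1) ^ p * Q ^ (p choose 2) / (poch Q p * poch Q (i - p)) / poch (x) (J - p)) =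
     (\<Sum>p\<le>i. (-1) ^ p * Q ^ (p choose 2) / (poch Q p * poch Q (i - p)) * poch (x * Q ^ (J - i) * Q ^ (i - p)) p / poch (x) J)"
  proof (rule sum.cong [OF refl])
    fix p assume "p \<in> {..i}"
    then have p: "p \<le> i" by simp
    have "poch (x) J = poch (x) (J - p) * poch (x * Q ^ (J - p)) p"
      using qpoch_add [of "x" q "J - p" p] p \<open>i \<le> J\<close> by simp
    moreover have "Q ^ (J - p) = Q ^ (J - i) * Q ^ (i - p)"
      using p \<open>i \<le> J\<close> by (simp flip: power_add)
    ultimately have "poch (x * Q ^ (J - i) * Q ^ (i - p)) p / poch (x) J = 1 / poch (x) (J - p)"
      using X by (simp add: mult_ac)
    then show "(-1) ^ p * Q ^ (p choose 2) / (poch Q p * poch Q (i - p)) / poch (x) (J - p) =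
       (-1) ^ p * Q ^ (p choose 2) / (poch Q p * poch Q (i - p)) * poch (x * Q ^ (J - i) * Q ^ (i - p)) p / poch (x) J"
      by (metis times_divide_eq_right mult.right_neutral)
  qed
  also have "\<dots> = (x * Q ^ (J - i)) ^ i * Q ^ (i * (i - 1)) / poch Q i / poch (x) J"
    by (simp only: sum_divide_distrib [symmetric] q_binomial_sum)
  finally show ?thesis .
qed

subsection \<open>A product formula for terminating \<open>2\<phi>2\<close> series\<close>

text \<open>With \<open>\<lambda>(J) = (e, g; q)\<^sub>J\<close> and \<open>e g q = c\<^sup>2\<close>, the coefficients below re-expand \<open>\<lambda>(N)\<close> times a
  \<open>2\<phi>2\<close> series in the \<open>\<lambda>(J)\<close>; see \<open>lam_linearization\<close>. The index \<open>(p, u, v)\<close> stands for \<open>N = u + v\<close>,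
  \<open>J = p + N\<close> and the power \<open>p + u\<close> of \<open>Y\<close>, which makes the support condition automatic.\<close>

definition lin_coeff :: "complex \<Rightarrow> nat \<Rightarrow> nat \<Rightarrow> nat \<Rightarrow> complex" where
  "lin_coeff c p u v = (-1) ^ p * Q ^ (p choose 2) * Q ^ p / Q ^ ((p + u) * v)
     * (poch Q (u + v) * poch c (u + v))
     / (poch Q p * poch Q u * poch c (p + u) * poch Q v * poch c v)"

definition lin_poly :: "complex \<Rightarrow> complex \<Rightarrow> nat \<Rightarrow> nat \<Rightarrow> complex" where
  "lin_poly c Y N p = (\<Sum>u\<le>N. lin_coeff c p u (N - u) * Y ^ (p + u))"

text \<open>The weight of the term N = u + v in \<open>jackson_sum\<close> cancels the numerator of
  \<open>lin_coeff\<close>. For fixed J = p + u + v and i = p + u, what remains depends on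
  \<open>p\<close> only through a sign, a power of \<open>q\<close> and (q;q)_p (q;q)_(i-p).\<close>

lemma lin_coeff_eq:
  assumes "poch x (u + v) \<noteq> 0"
  shows "Q ^ (u + v) / (poch Q (u + v) * poch x (u + v)) * lin_coeff x p u v =
    (-1) ^ p * Q ^ (p choose 2) * Q ^ (p + u + v) / Q ^ ((p + u) * v)
     / (poch Q p * poch Q u * poch x (p + u) * poch Q v * poch x v)"
  using assms by (simp add: lin_coeff_def power_add)

lemma lin_poly_0: "lin_poly c Y 0 p = (-1) ^ p * Q ^ (p choose 2) * (Q * Y) ^ p / (poch Q p * poch c p)"
  by (simp add: lin_poly_def lin_coeff_def power_mult_distrib)

text \<open>The recurrence in \<open>N\<close> that drives the induction in
  \<open>lam_linearization\<close>. It comes from splitting the weight \<open>D\<close>, the ratio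
  of the numerators of \<open>lin_coeff\<close> at N + 1 and at N.\<close>

lemma lin_poly_Suc:
  assumes "poch c (Suc (p + N)) \<noteq> 0"
  shows "lin_poly c Y (Suc N) p = (1 - c * Y * Q ^ (p + N)) / Q ^ p * lin_poly c Y N p
     + (1 - 1 / Q ^ Suc p) * (1 - c\<^sup>2 * Q ^ (2 * N + p)) * lin_poly c Y N (Suc p)"
proof -
  have nz: "poch c k \<noteq> 0" if "k \<le> Suc (p + N)" for k
    using qpoch_nonzero_mono assms that by blast
  have nz1: "1 - c * Q ^ k \<noteq> 0" if "k \<le> p + N" for k
    using nz [of "Suc k"] that by (simp add: qpoch_Suc)
  define D where "D = (1 - Q ^ Suc N) * (1 - c * Q ^ N)"
  have D: "D \<noteq> 0"
    unfolding D_def using nz1 [of N] by simp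
  \<comment> \<open>The right-hand side is sorted by powers of \<open>Y\<close>: exponent p + u goes
    into \<open>A\<close>, exponent p + u + 1 into \<open>B\<close>.\<close>
  define A where "A u v = lin_coeff c p u v * Y ^ (p + u) / Q ^ p" for u v
  define B where "B u v = lin_coeff c p u v * Y ^ (p + u) * (- c * Y * Q ^ (p + N)) / Q ^ p
     + (1 - 1 / Q ^ Suc p) * (1 - c\<^sup>2 * Q ^ (2 * N + p)) * (lin_coeff c (Suc p) u v * Y ^ (Suc p + u))" for u v
  have "lin_poly c Y (Suc N) p = (\<Sum>u\<le>N. A u (N - u) + B u (N - u))"
    unfolding lin_poly_def
  proof (rule sum_antidiagonal_Suc
      [where f = "\<lambda>u v. lin_coeff c p u v * Y ^ (p + u)"
       and a = "\<lambda>u v. lin_coeff c p u v * Y ^ (p + u) * (Q ^ u * (1 - Q ^ v) * (1 - c / Q * Q ^ v)) / D"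
       and b = "\<lambda>u v. lin_coeff c p u v * Y ^ (p + u) * ((1 - Q ^ u) * (1 - c / Q * Q ^ (u + 2 * v))) / D"])
    fix u v assume uv: "u + v = Suc N"
    have "D = (1 - Q ^ (u + v)) * (1 - c / Q * Q ^ (u + v))"
      unfolding D_def uv by simp
    also have "\<dots> = Q ^ u * (1 - Q ^ v) * (1 - c / Q * Q ^ v) + (1 - Q ^ u) * (1 - c / Q * Q ^ (u + 2 * v))"
      unfolding power_add power_double by (simp add: algebra_simps power2_eq_square add_divide_distrib diff_divide_distrib)
    finally have "(Q ^ u * (1 - Q ^ v) * (1 - c / Q * Q ^ v)) / D + (1 - Q ^ u) * (1 - c / Q * Q ^ (u + 2 * v)) / D = 1"
      using D by (simp add: add_divide_distrib [symmetric])
    then show "lin_coeff c p u v * Y ^ (p + u) =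
        lin_coeff c p u v * Y ^ (p + u) * (Q ^ u * (1 - Q ^ v) * (1 - c / Q * Q ^ v)) / D
        + lin_coeff c p u v * Y ^ (p + u) * ((1 - Q ^ u) * (1 - c / Q * Q ^ (u + 2 * v))) / D"
      by (simp flip: distrib_left times_divide_eq_right)
  next
    fix u v assume uv: "u + v = N"
    have nzs: "poch c (p + u) \<noteq> 0" "poch c v \<noteq> 0" "1 - c * Q ^ v \<noteq> 0" "1 - c * Q ^ (u + v) \<noteq> 0"
        "1 - c * Q ^ (p + u) \<noteq> 0" "poch c (u + v) \<noteq> 0"
      using nz nz1 uv by auto
    have nzs': "Q * (Q ^ u * Q ^ v) \<noteq> 1"
      by (metis Q_power_neq_1 power_add)
    have DD: "(1 - Q ^ Suc (u + v)) * (1 - c * Q ^ (u + v)) = D"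
      unfolding D_def uv ..
    have 1: "lin_coeff c p u (Suc v) = lin_coeff c p u v * D / (Q ^ (p + u) * (1 - Q ^ Suc v) * (1 - c * Q ^ v))"
      unfolding lin_coeff_def using nzs nzs' DD [symmetric]
      by (simp add: qpoch_Suc power_add divide_simps mult_ac)
    show "lin_coeff c p u (Suc v) * Y ^ (p + u) * (Q ^ u * (1 - Q ^ Suc v) * (1 - c / Q * Q ^ Suc v)) / D = A u v"
      unfolding 1 A_def using nzs D by (simp add: power_add divide_simps mult_ac)
    \<comment> \<open>Both coefficients occurring in \<open>B\<close> become multiples of the one at
      (p, u + 1, v), so that only their scalar factors have to be compared.\<close>
    have 2: "lin_coeff c p u v = lin_coeff c p (Suc u) v * ((1 - Q ^ Suc u) * (1 - c * Q ^ (p + u)) * Q ^ v) / D"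
      unfolding lin_coeff_def using nzs nzs' DD [symmetric]
      by (simp add: qpoch_Suc power_add divide_simps mult_ac)
    have 3: "lin_coeff c (Suc p) u v = - (lin_coeff c p (Suc u) v * ((1 - Q ^ Suc u) * Q ^ Suc p) / ((1 - Q ^ Suc p) * D))"
      unfolding lin_coeff_def using nzs nzs' DD [symmetric]
      by (simp add: qpoch_Suc power_add Suc_choose_2 divide_simps mult_ac)
    define P where "P = lin_coeff c p (Suc u) v"
    have "B u v = P * Y ^ (p + Suc u) * (1 - Q ^ Suc u) / D *
        (- c * Q ^ (p + N) * (1 - c * Q ^ (p + u)) * Q ^ v / Q ^ p
         - (1 - 1 / Q ^ Suc p) * (1 - c\<^sup>2 * Q ^ (2 * N + p)) * (Q ^ Suc p / (1 - Q ^ Suc p)))"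
      unfolding B_def 2 3 P_def [symmetric] using D by (simp add: divide_simps) (simp add: algebra_simps)
    also have "(1 - 1 / Q ^ Suc p) * (1 - c\<^sup>2 * Q ^ (2 * N + p)) * (Q ^ Suc p / (1 - Q ^ Suc p)) = - (1 - c\<^sup>2 * Q ^ (2 * N + p))"
      by (simp add: divide_simps) (simp add: algebra_simps)
    also have "- c * Q ^ (p + N) * (1 - c * Q ^ (p + u)) * Q ^ v / Q ^ p - - (1 - c\<^sup>2 * Q ^ (2 * N + p)) =
        1 - c / Q * Q ^ (Suc u + 2 * v)"
      unfolding uv [symmetric] power_add power_double by (simp add: power_add divide_simps) (simp add: algebra_simps power2_eq_square)
    finally show "lin_coeff c p (Suc u) v * Y ^ (p + Suc u) * ((1 - Q ^ Suc u) * (1 - c / Q * Q ^ (Suc u + 2 * v))) / D = B u v"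
      unfolding P_def by simp
  qed auto
  also have "\<dots> = (1 - c * Y * Q ^ (p + N)) / Q ^ p * lin_poly c Y N p
     + (1 - 1 / Q ^ Suc p) * (1 - c\<^sup>2 * Q ^ (2 * N + p)) * lin_poly c Y N (Suc p)"
    unfolding lin_poly_def sum_distrib_left sum.distrib [symmetric] A_def B_def
    by (rule sum.cong) (simp_all add: diff_divide_distrib algebra_simps)
  finally show ?thesis .
qed

context
  fixes m :: nat and e g c :: complex
begin

abbreviation "lam J \<equiv> poch e J * poch g J"

text \<open>The series 3phi2(e, g, 0; c, c X; q, q), cut off at \<open>m\<close>.\<close>

definition jackson_sum :: "complex \<Rightarrow> complex" where
  "jackson_sum X = (\<Sum>N\<le>m. lam N * Q ^ N / (poch Q N * poch c N * poch (c * X) N))"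

text \<open>The double sum of the product formula, arranged by J = i + l.\<close>

definition product_sum :: "complex \<Rightarrow> complex \<Rightarrow> complex" where
  "product_sum X Y = (\<Sum>J\<le>m. \<Sum>i\<le>J. lam J * Q ^ J / (poch (c * X) J * poch (c * Y) J)
      * (Q ^ (i * (i - 1)) * (c * X * Y) ^ i / (poch Q i * poch c i * poch Q (J - i) * poch c (J - i))))"

text \<open>The series 2phi2(e, g; c, c Y; q, q Y), cut off at \<open>m\<close>; for e = q^(-m) it
  is the full series, as \<open>phi22_eq_jackson22\<close> records.\<close>

definition jackson22 :: "complex \<Rightarrow> complex" where
  "jackson22 Y = (\<Sum>p\<le>m. lam p / (poch c p * poch (c * Y) p * poch Q p) * (-1) ^ p * Q ^ (p choose 2) * (Q * Y) ^ p)"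

context
  assumes e: "e * Q ^ m = 1" and eg: "e * g * Q = c\<^sup>2" and c: "poch c m \<noteq> 0"
begin

lemma lam_eq_0: "J > m \<Longrightarrow> lam J = 0"
proof -
  assume "J > m"
  moreover have "poch e (Suc m) = 0"
    using e by (simp add: qpoch_Suc)
  ultimately show ?thesis
    using qpoch_zero_mono [of e q "Suc m" J] by simp
qed

text \<open>By induction on \<open>N\<close>: multiplication by \<open>f\<close> raises
  \<open>lam N\<close> to \<open>lam (Suc N)\<close>, and on the right each
  \<open>f * lam (p + N)\<close> is re-expanded in \<open>lam (Suc (p + N))\<close> and
  \<open>lam (p + N)\<close>. The resulting coefficients obey \<open>lin_poly_Suc\<close> because e
  g q = c^2.\<close>

lemma lam_linearization:
  assumes Y: "poch (c * Y) m \<noteq> 0"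
  shows "lam N * (\<Sum>p\<le>m. lam p * lin_poly c Y 0 p / poch (c * Y) p) =
    (\<Sum>p\<le>m. lam (p + N) * lin_poly c Y N p / poch (c * Y) (p + N))"
proof (induction N)
  case 0
  show ?case by simp
next
  case (Suc N)
  define f where "f = (1 - e * Q ^ N) * (1 - g * Q ^ N)"
  define G where "G p = (1 - 1 / Q ^ p) * (1 - e * g * Q ^ (2 * N + p)) * lam (p + N) * lin_poly c Y N p
      / poch (c * Y) (p + N)" for p
  \<comment> \<open>Subtracting q^(-p) (1 - e q^(p+N)) (1 - g q^(p+N)) from \<open>f\<close>
    eliminates e + g, so the remainder involves only the product e g.\<close>
  have split: "f * lam (p + N) = lam (Suc (p + N)) / Q ^ p + (1 - 1 / Q ^ p) * (1 - e * g * Q ^ (2 * N + p)) * lam (p + N)" for p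
    unfolding f_def power_add power_double by (simp add: qpoch_Suc divide_simps power_add) (simp add: algebra_simps power2_eq_square)
  have "lam (Suc N) * (\<Sum>p\<le>m. lam p * lin_poly c Y 0 p / poch (c * Y) p) =
      f * (\<Sum>p\<le>m. lam (p + N) * lin_poly c Y N p / poch (c * Y) (p + N))"
    unfolding Suc [symmetric] f_def by (simp add: qpoch_Suc mult_ac)
  also have "\<dots> = (\<Sum>p\<le>m. lam (Suc (p + N)) / Q ^ p * lin_poly c Y N p / poch (c * Y) (p + N)) + (\<Sum>p\<le>m. G p)"
    unfolding sum_distrib_left sum.distrib [symmetric]
  proof (rule sum.cong [OF refl])
    fix p
    have "f * (lam (p + N) * lin_poly c Y N p / poch (c * Y) (p + N)) = (f * lam (p + N)) * (lin_poly c Y N p / poch (c * Y) (p + N))"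
      by simp
    also have "\<dots> = lam (Suc (p + N)) / Q ^ p * lin_poly c Y N p / poch (c * Y) (p + N) + G p"
      unfolding split G_def by (simp only: distrib_right) simp
    finally show "f * (lam (p + N) * lin_poly c Y N p / poch (c * Y) (p + N)) =
        lam (Suc (p + N)) / Q ^ p * lin_poly c Y N p / poch (c * Y) (p + N) + G p" .
  qed
  \<comment> \<open>The shift loses nothing: \<open>G 0\<close> contains the factor 1 - 1/q^0, and
    \<open>G (Suc m)\<close> contains a value of \<open>lam\<close> beyond \<open>m\<close>.\<close>
  also have "(\<Sum>p\<le>m. G p) = (\<Sum>p\<le>m. G (Suc p))"
  proof -
    have "(\<Sum>p\<le>Suc m. G p) = (\<Sum>p\<le>m. G p)"
      using lam_eq_0 [of "Suc m + N"] unfolding G_def by simp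
    moreover have "(\<Sum>p\<le>Suc m. G p) = (\<Sum>p\<le>m. G (Suc p))"
      by (subst sum.atMost_Suc_shift) (simp add: G_def)
    ultimately show ?thesis by simp
  qed
  also have "(\<Sum>p\<le>m. lam (Suc (p + N)) / Q ^ p * lin_poly c Y N p / poch (c * Y) (p + N)) + (\<Sum>p\<le>m. G (Suc p)) =
      (\<Sum>p\<le>m. lam (p + Suc N) * lin_poly c Y (Suc N) p / poch (c * Y) (p + Suc N))"
    unfolding sum.distrib [symmetric]
  proof (rule sum.cong [OF refl])
    fix p
    show "lam (Suc (p + N)) / Q ^ p * lin_poly c Y N p / poch (c * Y) (p + N) + G (Suc p) =
        lam (p + Suc N) * lin_poly c Y (Suc N) p / poch (c * Y) (p + Suc N)"
    \<comment> \<open>Within the range all shifted factorials in the denominators are nonzero;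
      beyond it \<open>lam\<close> vanishes and both sides are 0, whatever the denominators
      are.\<close>
    proof (cases "Suc (p + N) \<le> m")
      case True
      have "poch c (Suc (p + N)) \<noteq> 0"
        using qpoch_nonzero_mono c True by blast
      note 1 = lin_poly_Suc [OF this, of Y]
      have "poch (c * Y) (Suc (p + N)) \<noteq> 0"
        using qpoch_nonzero_mono Y True by blast
      then have nz: "poch (c * Y) (p + N) \<noteq> 0" "1 - c * Y * Q ^ (p + N) \<noteq> 0"
        by (auto simp: qpoch_Suc)
      have 2: "e * g * Q ^ (2 * N + Suc p) = c\<^sup>2 * Q ^ (2 * N + p)"
        unfolding eg [symmetric] by (simp add: power_add mult_ac)
      have 3: "poch (c * Y) (Suc (p + N)) = poch (c * Y) (p + N) * (1 - c * Y * Q ^ (p + N))"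
        by (rule qpoch_Suc)
      define l where "l = lam (Suc (p + N))"
      have l: "lam (Suc p + N) = l" "lam (p + Suc N) = l"
        by (simp_all add: l_def)
      show ?thesis
        unfolding G_def 2 unfolding l l_def [symmetric] add_Suc add_Suc_right 1 3 using nz
        by (simp add: add_divide_distrib distrib_left)
    next
      case False
      then have z: "lam (Suc (p + N)) = 0"
        by (intro lam_eq_0) auto
      show ?thesis
        unfolding G_def add_Suc add_Suc_right z by simp
    qed
  qed
  finally show ?case .
qed

text \<open>Each \<open>lam N\<close> in the 3phi2 series is multiplied into the 2phi2 series by
  \<open>lam_linearization\<close>. Reordering the triple sum by J = p + N and i = p + u isolates a
  sum over \<open>p\<close>, which \<open>inner_q_binomial\<close> evaluates.\<close>

lemma jackson_sum_mult:
  assumes X: "poch (c * X) m \<noteq> 0" and Y: "poch (c * Y) m \<noteq> 0"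
  shows "jackson_sum X * (\<Sum>p\<le>m. lam p * lin_poly c Y 0 p / poch (c * Y) p) = product_sum X Y"
proof -
  \<comment> \<open>The last factor contains all that still depends on \<open>p\<close> once p + u +
    v and p + u are fixed.\<close>
  define F where "F p u v = lam (p + u + v) * Q ^ (p + u + v) / poch (c * Y) (p + u + v) * Y ^ (p + u) / Q ^ ((p + u) * v)
      / (poch c (p + u) * poch Q v * poch c v)
      * ((-1) ^ p * Q ^ (p choose 2) / (poch Q p * poch Q u) / poch (c * X) (u + v))" for p u v
  have cnz: "poch c k \<noteq> 0" if "k \<le> m" for k
    using qpoch_nonzero_mono c that by blast
  have "jackson_sum X * (\<Sum>p\<le>m. lam p * lin_poly c Y 0 p / poch (c * Y) p) =
     (\<Sum>N\<le>m. Q ^ N / (poch Q N * poch c N * poch (c * X) N) * (\<Sum>p\<le>m. lam (p + N) * lin_poly c Y N p / poch (c * Y) (p + N)))"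
    unfolding lam_linearization [OF Y, symmetric] jackson_sum_def sum_distrib_right
    by (rule sum.cong) auto
  also have "\<dots> = (\<Sum>N\<le>m. \<Sum>p\<le>m - N. \<Sum>u\<le>N. F p u (N - u))"
  proof (rule sum.cong [OF refl])
    fix N assume "N \<in> {..m}"
    then have N: "N \<le> m" by simp
    \<comment> \<open>Discarding the terms with p + N > m, where \<open>lam\<close> vanishes,
      confines J = p + N to the range up to \<open>m\<close>.\<close>
    have "(\<Sum>p\<le>m. lam (p + N) * lin_poly c Y N p / poch (c * Y) (p + N)) =
       (\<Sum>p\<le>m - N. lam (p + N) * lin_poly c Y N p / poch (c * Y) (p + N))"
    proof (rule sum.mono_neutral_right)
      show "\<forall>p\<in>{..m} - {..m - N}. lam (p + N) * lin_poly c Y N p / poch (c * Y) (p + N) = 0"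
      proof
        fix p assume "p \<in> {..m} - {..m - N}"
        then have "lam (p + N) = 0"
          by (intro lam_eq_0) auto
        then show "lam (p + N) * lin_poly c Y N p / poch (c * Y) (p + N) = 0"
          by (simp only: mult_zero_left div_0)
      qed
    qed auto
    then have "Q ^ N / (poch Q N * poch c N * poch (c * X) N) * (\<Sum>p\<le>m. lam (p + N) * lin_poly c Y N p / poch (c * Y) (p + N)) =
       (\<Sum>p\<le>m - N. Q ^ N / (poch Q N * poch c N * poch (c * X) N) * (lam (p + N) * lin_poly c Y N p / poch (c * Y) (p + N)))"
      by (simp only: sum_distrib_left)
    also have "\<dots> = (\<Sum>p\<le>m - N. \<Sum>u\<le>N. F p u (N - u))"
    proof (rule sum.cong [OF refl])
      fix p
      have "Q ^ N / (poch Q N * poch c N * poch (c * X) N) * (lam (p + N) * lin_poly c Y N p / poch (c * Y) (p + N)) =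
        (\<Sum>u\<le>N. (Q ^ N / (poch Q N * poch c N) * lin_coeff c p u (N - u)) * (lam (p + N) / poch (c * Y) (p + N) * Y ^ (p + u) / poch (c * X) N))"
        unfolding lin_poly_def sum_distrib_left sum_divide_distrib by (rule sum.cong) (auto simp: mult_ac)
      also have "\<dots> = (\<Sum>u\<le>N. F p u (N - u))"
      proof (rule sum.cong [OF refl])
        fix u assume "u \<in> {..N}"
        then have uN: "u + (N - u) = N" "p + u + (N - u) = p + N" by auto
        show "Q ^ N / (poch Q N * poch c N) * lin_coeff c p u (N - u) * (lam (p + N) / poch (c * Y) (p + N) * Y ^ (p + u) / poch (c * X) N) = F p u (N - u)"
          using lin_coeff_eq [of c u "N - u" p] cnz [OF N] unfolding F_def uN by (simp add: mult_ac)
      qed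
      finally show "Q ^ N / (poch Q N * poch c N * poch (c * X) N) * (lam (p + N) * lin_poly c Y N p / poch (c * Y) (p + N)) = (\<Sum>u\<le>N. F p u (N - u))" .
    qed
    finally show "Q ^ N / (poch Q N * poch c N * poch (c * X) N) * (\<Sum>p\<le>m. lam (p + N) * lin_poly c Y N p / poch (c * Y) (p + N)) =
        (\<Sum>p\<le>m - N. \<Sum>u\<le>N. F p u (N - u))" .
  qed
  also have "\<dots> = (\<Sum>(N, p, u)\<in>(SIGMA N:{..m}. SIGMA p:{..m - N}. {..N}). F p u (N - u))"
    by (simp add: sum.Sigma)
  also have "\<dots> = (\<Sum>(J, i, p)\<in>(SIGMA J:{..m}. SIGMA i:{..J}. {..i}). F p (i - p) (J - i))"
    by (rule sum.reindex_bij_witness [where i = "\<lambda>(J, i, p). (J - p, p, i - p)" and j = "\<lambda>(N, p, u). (p + N, p + u, p)"]) auto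
  also have "\<dots> = (\<Sum>J\<le>m. \<Sum>i\<le>J. \<Sum>p\<le>i. F p (i - p) (J - i))"
    by (simp add: sum.Sigma)
  also have "\<dots> = product_sum X Y"
    unfolding product_sum_def
  proof (intro sum.cong [OF refl])
    fix J i assume "J \<in> {..m}" "i \<in> {..J}"
    then have J: "J \<le> m" and i: "i \<le> J" by auto
    have "(\<Sum>p\<le>i. F p (i - p) (J - i)) = (\<Sum>p\<le>i. lam J * Q ^ J / poch (c * Y) J * Y ^ i / Q ^ (i * (J - i))
      / (poch c i * poch Q (J - i) * poch c (J - i))
      * ((-1) ^ p * Q ^ (p choose 2) / (poch Q p * poch Q (i - p)) / poch (c * X) (J - p)))"
      using i by (intro sum.cong) (auto simp: F_def)
    also have "\<dots> = lam J * Q ^ J / poch (c * Y) J * Y ^ i / Q ^ (i * (J - i))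
      / (poch c i * poch Q (J - i) * poch c (J - i)) *
      ((c * X * Q ^ (J - i)) ^ i * Q ^ (i * (i - 1)) / poch Q i / poch (c * X) J)"
      unfolding sum_distrib_left [symmetric]
      using inner_q_binomial [OF qpoch_nonzero_mono [OF X J] i] by simp
    also have "\<dots> = lam J * Q ^ J / (poch (c * X) J * poch (c * Y) J)
      * (Q ^ (i * (i - 1)) * (c * X * Y) ^ i / (poch Q i * poch c i * poch Q (J - i) * poch c (J - i)))"
    proof -
      have "(Q ^ (J - i)) ^ i = Q ^ (i * (J - i))"
        by (simp add: power_mult [symmetric] mult.commute)
      then have "(c * X * Q ^ (J - i)) ^ i = (c * X) ^ i * Q ^ (i * (J - i))"
        by (simp only: power_mult_distrib)
      moreover have "(c * X * Y) ^ i = (c * X) ^ i * Y ^ i"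
        by (simp only: power_mult_distrib)
      ultimately show ?thesis by (simp add: mult_ac)
    qed
    finally show "(\<Sum>p\<le>i. F p (i - p) (J - i)) = lam J * Q ^ J / (poch (c * X) J * poch (c * Y) J)
      * (Q ^ (i * (i - 1)) * (c * X * Y) ^ i / (poch Q i * poch c i * poch Q (J - i) * poch c (J - i)))" .
  qed
  finally show ?thesis .
qed

text \<open>With e = q^(-m) each factor 1 - e q^N equals -(1 - q^(m-N)) q^N / q^m. The powers are
  kept in the shape in which they occur in \<open>vandermonde_sum\<close>.\<close>

lemma poch_e: "N \<le> m \<Longrightarrow> poch e N = (-1) ^ N * Q ^ (N choose 2) * poch Q m / ((Q ^ N) ^ m * poch Q (m - N))"
proof (induction N)
  case 0
  show ?case by simp
next
  case (Suc N)
  have m: "m = Suc (N + (m - Suc N))" "m - N = Suc (m - Suc N)"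
    using Suc by auto
  have e': "1 - e * Q ^ N = - (1 - Q ^ (m - N)) * Q ^ N / Q ^ m"
  proof -
    have "Q ^ m = Q ^ (m - N) * Q ^ N"
      using Suc by (simp flip: power_add)
    moreover have "e = 1 / Q ^ m"
      using e by (simp add: divide_simps)
    ultimately show ?thesis by (simp add: divide_simps algebra_simps)
  qed
  show ?case
    unfolding qpoch_Suc [of e] e' Suc.IH [OF Suc_leD [OF Suc.prems]] m(2)
    by (simp add: qpoch_Suc Suc_choose_2 power_add power_mult_distrib divide_simps) (simp add: algebra_simps)
qed

lemma vandermonde:
  "(\<Sum>N\<le>m. lam N * Q ^ N / (poch Q N * poch c N)) = (\<Prod>r<m. g - c * Q ^ r) / poch c m"
proof -
  have "(\<Sum>N\<le>m. lam N * Q ^ N / (poch Q N * poch c N)) =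
     (\<Sum>N\<le>m. poch Q m / poch c m * ((-1) ^ N * Q ^ (N choose 2) * Q ^ N / (Q ^ N) ^ m / (poch Q N * poch Q (m - N))
      * poch g N * poch (c * Q ^ N) (m - N)))"
  proof (rule sum.cong [OF refl])
    fix N assume "N \<in> {..m}"
    then have N: "N \<le> m" by simp
    have "poch c m = poch c N * poch (c * Q ^ N) (m - N)"
      using qpoch_add [of c q N "m - N"] N by simp
    then show "lam N * Q ^ N / (poch Q N * poch c N) = poch Q m / poch c m * ((-1) ^ N * Q ^ (N choose 2) * Q ^ N / (Q ^ N) ^ m / (poch Q N * poch Q (m - N))
      * poch g N * poch (c * Q ^ N) (m - N))"
      using c by (simp add: poch_e [OF N] divide_simps mult_ac)
  qed
  then show ?thesis
    by (simp only: sum_distrib_left [symmetric] vandermonde_sum) simp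
qed

text \<open>Here g = c^2 q^(m-1). After reversal of the product in \<open>vandermonde\<close>, its
  factors are -c q^(m-1-r) (1 - c q^r), so that (c;q)_m cancels and only a monomial is left.\<close>

lemma jackson_sum_0: "jackson_sum 0 = (- c) ^ m * Q ^ (m choose 2)"
proof -
  have "(\<Prod>r<m. g - c * Q ^ r) = (\<Prod>r<m. g - c * Q ^ (m - Suc r))"
    by (subst prod.nat_diff_reindex) simp
  also have "\<dots> = (\<Prod>r<m. (- c) * Q ^ (m - Suc r) * (1 - c * Q ^ r))"
  proof (rule prod.cong [OF refl])
    fix r assume "r \<in> {..<m}"
    then have "Q ^ m = Q ^ (m - Suc r) * Q ^ r * Q"
      by (simp flip: power_add power_Suc2)
    moreover have "g * Q = c\<^sup>2 * Q ^ m"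
      using e eg by (metis mult.assoc mult.commute mult.right_neutral)
    ultimately have "g * Q = c\<^sup>2 * (Q ^ (m - Suc r) * Q ^ r) * Q"
      by simp
    then have "g = c\<^sup>2 * (Q ^ (m - Suc r) * Q ^ r)"
      by simp
    then show "g - c * Q ^ (m - Suc r) = (- c) * Q ^ (m - Suc r) * (1 - c * Q ^ r)"
      by (simp add: algebra_simps power2_eq_square)
  qed
  also have "\<dots> = (- c) ^ m * (\<Prod>r<m. Q ^ (m - Suc r)) * poch c m"
    by (simp only: prod.distrib qpoch_def prod_constant card_lessThan)
  also have "(\<Prod>r<m. Q ^ (m - Suc r)) = (\<Prod>r<m. Q ^ r)"
    by (rule prod.nat_diff_reindex)
  also have "(\<Prod>r<m. Q ^ r) = Q ^ (m choose 2)"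
    by (induction m) (simp_all add: Suc_choose_2 power_add)
  finally show ?thesis
    using vandermonde c by (simp add: jackson_sum_def)
qed

text \<open>\<open>jackson_sum_mult\<close> is used twice: with first argument 0 it turns the 3phi2
  series at \<open>X\<close> into a multiple of the 2phi2 series at \<open>X\<close>, and with (X,
  Y) it then gives the product of the two 2phi2 series.\<close>

lemma jackson22_product:
  assumes X: "poch (c * X) m \<noteq> 0" and Y: "poch (c * Y) m \<noteq> 0"
  shows "(- c) ^ m * Q ^ (m choose 2) * jackson22 X * jackson22 Y = product_sum X Y"
proof -
  have 1: "jackson22 Z = (\<Sum>p\<le>m. lam p * lin_poly c Z 0 p / poch (c * Z) p)" for Z
    unfolding jackson22_def lin_poly_0 by (rule sum.cong) (auto simp: mult_ac)
  \<comment> \<open>Taking one argument to be \<open>0\<close> gives the transformation from \<open>2\<phi>2\<close> to \<open>3\<phi>2\<close>.\<close>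
  have "product_sum 0 X = jackson_sum X"
  proof -
    have "product_sum 0 X = (\<Sum>J\<le>m. \<Sum>i\<in>{0}. lam J * Q ^ J / (poch (c * 0) J * poch (c * X) J)
      * (Q ^ (i * (i - 1)) * (c * 0 * X) ^ i / (poch Q i * poch c i * poch Q (J - i) * poch c (J - i))))"
      unfolding product_sum_def by (intro sum.cong sum.mono_neutral_right) auto
    also have "\<dots> = jackson_sum X"
      unfolding jackson_sum_def by (rule sum.cong) (auto simp: qpoch_def mult_ac)
    finally show ?thesis .
  qed
  then have "jackson_sum X = (- c) ^ m * Q ^ (m choose 2) * jackson22 X"
    using jackson_sum_mult [of 0 X] X jackson_sum_0 1 by (simp add: qpoch_def)
  then show ?thesis
    using jackson_sum_mult [OF X Y] 1 by simp
qed

end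
end

subsection \<open>Three-term recurrence of the continuous \<open>q\<close>-ultraspherical polynomials\<close>

abbreviation "rootQ \<equiv> complex_of_real (sqrt q)"

lemma rootQ_square: "rootQ * rootQ = Q"
  using q_pos by (simp flip: of_real_mult)

lemma rootQ_nonzero [simp]: "rootQ \<noteq> 0"
  using q_pos by simp

text \<open>With \<open>y\<close> = 2 cos(theta) this is (w e^(i theta), w e^(-i theta); q)_j, see
  \<open>poch_exp_pair\<close>. Taking \<open>y\<close> as the variable makes multiplication by
  \<open>y\<close>, and hence the recurrence, algebraic.\<close>

definition aw_basis :: "complex \<Rightarrow> complex \<Rightarrow> nat \<Rightarrow> complex" where
  "aw_basis w y j = (\<Prod>i<j. 1 - w * y * Q ^ i + w\<^sup>2 * Q ^ (2 * i))"

lemma aw_basis_0 [simp]: "aw_basis w y 0 = 1"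
  by (simp add: aw_basis_def)

lemma aw_basis_Suc: "aw_basis w y (Suc j) = aw_basis w y j * (1 - w * y * Q ^ j + w\<^sup>2 * Q ^ (2 * j))"
  by (simp add: aw_basis_def)

lemma poch_exp_pair:
  "poch (w * exp (\<i> * \<theta>)) j * poch (w * exp (- (\<i> * \<theta>))) j = aw_basis w (2 * cos \<theta>) j"
  unfolding qpoch_def aw_basis_def prod.distrib [symmetric]
proof (rule prod.cong [OF refl])
  fix i
  have "exp (\<i> * \<theta>) * exp (- (\<i> * \<theta>)) = 1"
    by (simp flip: exp_add)
  moreover have "2 * cos \<theta> = exp (\<i> * \<theta>) + exp (- (\<i> * \<theta>))"
    by (simp add: cos_exp_eq)
  moreover have "(1 - w * x * c) * (1 - w * x' * c) = 1 - w * (x + x') * c + w\<^sup>2 * (x * x') * (c * c)" for x x' c :: complex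
    by (simp add: algebra_simps power2_eq_square)
  ultimately show "(1 - w * exp (\<i> * \<theta>) * Q ^ i) * (1 - w * exp (- (\<i> * \<theta>)) * Q ^ i) =
      1 - w * (2 * cos \<theta>) * Q ^ i + w\<^sup>2 * Q ^ (2 * i)"
    by (simp add: power_double)
qed

lemma aw_r_eq_sum:
  "aw_r n \<theta> a b c d q =
    (\<Sum>j\<le>n. poch (Q powi (- int n)) j * poch (a * b * c * d * Q powi (int n - 1)) j * Q ^ j
      / (poch (a * b) j * poch (a * c) j * poch (a * d) j * poch Q j) * aw_basis a (2 * cos \<theta>) j)"
  unfolding aw_r_def phi43_terminates [OF q_nonzero] poch_exp_pair [symmetric]
  by (simp add: qpochs_def mult_ac)

context
  fixes a y :: complex
begin

abbreviation "ultra_denom j \<equiv> poch Q j * poch (- (a\<^sup>2)) j * (poch (a\<^sup>2 * rootQ) j * poch (- (a\<^sup>2 * rootQ)) j)"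

text \<open>The polynomial r_k with parameters a, -a, a q^(1/2), -a q^(1/2), by
  \<open>ultra_eq_aw_r\<close>.\<close>

definition ultra :: "nat \<Rightarrow> complex" where
  "ultra k = (\<Sum>j\<le>k. poch (Q powi (- int k)) j * poch (a ^ 4 * Q ^ k) j * Q ^ j / ultra_denom j * aw_basis a y j)"

lemma ultra_denom_Suc:
  "ultra_denom (Suc j) = ultra_denom j * ((1 - Q * Q ^ j) * (1 + a\<^sup>2 * Q ^ j) * (1 - a ^ 4 * Q * Q ^ (2 * j)))"
proof -
  have "(1 - a\<^sup>2 * rootQ * Q ^ j) * (1 + a\<^sup>2 * rootQ * Q ^ j) = 1 - a ^ 4 * (rootQ * rootQ) * Q ^ (2 * j)"
    unfolding power_double by (simp add: algebra_simps power4_eq_xxxx power2_eq_square)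
  then show ?thesis
    unfolding rootQ_square by (simp add: qpoch_Suc mult_ac)
qed

text \<open>Multiplication by \<open>y\<close> maps \<open>aw_basis a y j\<close> to a combination
  of the basis functions j and j + 1, so the coefficients at each basis function can be compared. At
  k = 0 the factor 1 - q^k removes the term with the truncated index \<open>k - 1\<close>.\<close>

lemma ultra_recurrence:
  assumes nz: "ultra_denom (Suc k) \<noteq> 0" and a: "a \<noteq> 0"
  shows "(1 - a ^ 4 * Q ^ k) * ultra (Suc k) =
    a * y * (1 - a\<^sup>2 * Q ^ k) * ultra k - a\<^sup>2 * (1 - Q ^ k) * ultra (k - 1)"
proof -
  define t where "t k j = poch (Q powi (- int k)) j * poch (a ^ 4 * Q ^ k) j * Q ^ j / ultra_denom j" for k j
  define b where "b = a\<^sup>2"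
  have b4: "a ^ 4 = b\<^sup>2"
    by (simp add: b_def)
  \<comment> \<open>All three polynomials are summed over one range; the surplus terms vanish
    because the shifted factorial of q^(-k') does.\<close>
  have extend: "ultra k' = (\<Sum>j\<le>Suc k. t k' j * aw_basis a y j)" if "k' \<le> Suc k" for k'
    unfolding ultra_def t_def using that
    by (intro sum.mono_neutral_left) (auto simp: qpoch_neg_power_eq_0)
  have y: "a * y * aw_basis a y j = ((1 + b * Q ^ (2 * j)) * aw_basis a y j - aw_basis a y (Suc j)) / Q ^ j" for j
    unfolding aw_basis_Suc b_def by (simp add: divide_simps) (simp add: algebra_simps)
  have t0: "t k' 0 = 1" for k'
    by (simp add: t_def)
  have coeff: "(1 - b\<^sup>2 * Q ^ k) * t (Suc k) (Suc j) =
      (1 - b * Q ^ k) * ((1 + b * Q ^ (2 * Suc j)) / Q ^ Suc j * t k (Suc j) - t k j / Q ^ j)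
      - b * (1 - Q ^ k) * t (k - 1) (Suc j)" if j: "j \<le> k" for j
  proof -
    define w where "w = poch (Q powi (- int k)) j"
    define v where "v = poch (b\<^sup>2 * Q ^ k) j"
    define r where "r = Q ^ k"
    define p where "p = Q ^ j"
    define L where "L = (1 - Q * p) * (1 + b * p) * (1 - b\<^sup>2 * Q * p\<^sup>2)"
    have r: "r \<noteq> 0" and p: "p \<noteq> 0"
      by (simp_all add: r_def p_def)
    have pow: "Q powi (- int k) = 1 / r" "Q powi (- int (Suc k)) = 1 / (Q * r)"
      by (simp_all add: r_def power_int_minus divide_inverse del: of_nat_Suc)
    have "ultra_denom j * L \<noteq> 0" and dS: "ultra_denom (Suc j) = ultra_denom j * L"
    proof -
      show dS: "ultra_denom (Suc j) = ultra_denom j * L"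
        unfolding ultra_denom_Suc L_def b4 b_def p_def by (simp add: power_double power2_eq_square)
      have "poch (- (a\<^sup>2)) (Suc j) \<noteq> 0" "poch (a\<^sup>2 * rootQ) (Suc j) \<noteq> 0" "poch (- (a\<^sup>2 * rootQ)) (Suc j) \<noteq> 0"
        using nz j qpoch_nonzero_mono [of _ q "Suc k" "Suc j"] by auto
      then have "ultra_denom (Suc j) \<noteq> 0"
        by simp
      then show "ultra_denom j * L \<noteq> 0"
        unfolding dS .
    qed
    then have D: "ultra_denom j \<noteq> 0" and L: "L \<noteq> 0" by auto
    have "poch (Q powi (- int (Suc k))) (Suc j) = (1 - 1 / (Q * r)) * w"
      unfolding qpoch_Suc_left w_def pow by simp
    moreover have "(1 - b\<^sup>2 * r) * poch (b\<^sup>2 * Q ^ Suc k) (Suc j) = v * (1 - b\<^sup>2 * r * p) * (1 - b\<^sup>2 * r * (Q * p))"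
    proof -
      have "(1 - b\<^sup>2 * r) * poch (b\<^sup>2 * Q ^ Suc k) (Suc j) = poch (b\<^sup>2 * Q ^ k) (Suc (Suc j))"
        unfolding qpoch_Suc_left [of "b\<^sup>2 * Q ^ k" q "Suc j"] by (simp add: r_def mult_ac)
      then show ?thesis
        unfolding qpoch_Suc [of "b\<^sup>2 * Q ^ k"] v_def r_def p_def by (simp add: mult_ac)
    qed
    moreover have "(1 - b\<^sup>2 * Q ^ k) * t (Suc k) (Suc j) = poch (Q powi (- int (Suc k))) (Suc j)
        * ((1 - b\<^sup>2 * r) * poch (b\<^sup>2 * Q ^ Suc k) (Suc j)) * (Q * p) / (ultra_denom j * L)"
      unfolding t_def dS b4 r_def p_def by simp
    ultimately have 1: "(1 - b\<^sup>2 * Q ^ k) * t (Suc k) (Suc j) =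
       (1 - 1 / (Q * r)) * w * (v * (1 - b\<^sup>2 * r * p) * (1 - b\<^sup>2 * r * (Q * p))) * (Q * p) / (ultra_denom j * L)"
      by simp
    have 2: "t k (Suc j) = w * (1 - p / r) * (v * (1 - b\<^sup>2 * r * p)) * (Q * p) / (ultra_denom j * L)"
      unfolding t_def dS b4 qpoch_Suc [of "Q powi _"] qpoch_Suc [of "b\<^sup>2 * _"]
      by (simp add: w_def v_def r_def p_def pow power_int_minus divide_inverse)
    have 3: "t k j = w * v * p / ultra_denom j"
      unfolding t_def b4 w_def v_def p_def by simp
    have 4: "(1 - Q ^ k) * t (k - 1) (Suc j) =
        - r * (w * (1 - p / r) * (1 - Q * p / r)) * ((1 - b\<^sup>2 * r / Q) * v) * (Q * p) / (ultra_denom j * L)"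
    \<comment> \<open>For k = 0 also j = 0, and both sides vanish. Otherwise 1 - q^k is absorbed as
      the missing first factor of the shifted factorial of q^(-k).\<close>
    proof (cases k)
      case 0
      show ?thesis
        using j by (simp add: 0 r_def p_def w_def)
    next
      case (Suc k')
      have "(1 - r) * poch (Q powi (- int k')) (Suc j) = - r * ((1 - 1 / r) * poch (Q powi (- int k')) (Suc j))"
        using r by (simp add: divide_simps algebra_simps)
      also have "(1 - 1 / r) * poch (Q powi (- int k')) (Suc j) = poch (Q powi (- int k)) (Suc (Suc j))"
      proof -
        have "Q powi (- int k) * Q = Q powi (- int k')"
          by (simp only: power_int_minus power_int_of_nat) (simp add: Suc)
        then show ?thesis
          unfolding qpoch_Suc_left [of "Q powi (- int k)" q "Suc j"] by (simp add: pow(1))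
      qed
      also have "\<dots> = w * (1 - p / r) * (1 - Q * p / r)"
        unfolding qpoch_Suc w_def by (simp add: r_def p_def pow power_int_minus divide_inverse mult_ac)
      finally have 41: "(1 - r) * poch (Q powi (- int k')) (Suc j) = - r * (w * (1 - p / r) * (1 - Q * p / r))" .
      have "poch (b\<^sup>2 * Q ^ k') (Suc j) = (1 - b\<^sup>2 * r / Q) * v"
        unfolding qpoch_Suc_left v_def by (simp add: r_def Suc mult_ac)
      then show ?thesis
        using 41 unfolding t_def dS b4 r_def [symmetric]
        by (simp add: Suc p_def mult.assoc [symmetric])
    qed
    \<comment> \<open>The factor common to all four coefficients; taking it out leaves exactly
      \<open>ultra_coeff_identity\<close>.\<close>
    define C where "C = w * v * p / (ultra_denom j * L)"
    have "(1 - b * r) * ((1 + b * (Q * p)\<^sup>2) / (Q * p) * ((1 - p / r) * (1 - b\<^sup>2 * r * p) * Q) - L / p)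
        + b * r * ((1 - p / r) * (1 - Q * p / r) * (1 - b\<^sup>2 * r / Q) * Q)
        = (1 - 1 / (Q * r)) * ((1 - b\<^sup>2 * r * p) * (1 - b\<^sup>2 * r * (Q * p))) * Q"
      unfolding L_def by (rule ultra_coeff_identity [OF r p Q_nonzero])
    then have key: "C * ((1 - b * r) * ((1 + b * (Q * p)\<^sup>2) / (Q * p) * ((1 - p / r) * (1 - b\<^sup>2 * r * p) * Q) - L / p)
        + b * r * ((1 - p / r) * (1 - Q * p / r) * (1 - b\<^sup>2 * r / Q) * Q))
        = C * ((1 - 1 / (Q * r)) * ((1 - b\<^sup>2 * r * p) * (1 - b\<^sup>2 * r * (Q * p))) * Q)"
      by simp
    have k1: "(1 - b\<^sup>2 * Q ^ k) * t (Suc k) (Suc j) = C * ((1 - 1 / (Q * r)) * ((1 - b\<^sup>2 * r * p) * (1 - b\<^sup>2 * r * (Q * p))) * Q)"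
      unfolding 1 C_def by simp
    have k2: "t k (Suc j) = C * ((1 - p / r) * (1 - b\<^sup>2 * r * p) * Q)"
      unfolding 2 C_def by simp
    have k3: "t k j = C * L"
      unfolding 3 C_def using L by simp
    have k4: "(1 - Q ^ k) * t (k - 1) (Suc j) = - (C * (r * ((1 - p / r) * (1 - Q * p / r) * (1 - b\<^sup>2 * r / Q) * Q)))"
      unfolding 4 C_def by simp
    have QQ: "Q ^ (2 * Suc j) = (Q * p)\<^sup>2" "Q ^ Suc j = Q * p" "Q ^ j = p"
      by (simp_all add: p_def power2_eq_square power_double)
    have k5: "b * (1 - Q ^ k) * t (k - 1) (Suc j) =
        - (C * (b * r * ((1 - p / r) * (1 - Q * p / r) * (1 - b\<^sup>2 * r / Q) * Q)))"
      unfolding mult.assoc [of b "1 - Q ^ k"] k4 by simp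
    have "C * (x * (u * V - L / p) + W) = x * (u * (C * V) - C * L / p) - - (C * W)" for x u V W
      by (simp add: algebra_simps)
    then show ?thesis
      unfolding QQ r_def [symmetric] k1 [folded r_def] k2 k3 k5 [folded r_def] key [symmetric] .
  qed
  \<comment> \<open>The comparison at the basis function of index 0, where each polynomial has
    coefficient 1.\<close>
  have coeff0: "1 - b\<^sup>2 * Q ^ k = (1 - b * Q ^ k) * (1 + b) - b * (1 - Q ^ k)"
    by (simp add: algebra_simps power2_eq_square)
  define \<phi> where "\<phi> = aw_basis a y"
  have "a * y * ultra k = (\<Sum>j\<le>k. t k j * (a * y * \<phi> j))"
    unfolding ultra_def t_def sum_distrib_left \<phi>_def by (rule sum.cong) auto
  also have "\<dots> = (\<Sum>j\<le>k. t k j * (1 + b * Q ^ (2 * j)) / Q ^ j * \<phi> j - t k j / Q ^ j * \<phi> (Suc j))"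
    unfolding \<phi>_def y by (rule sum.cong) (auto simp: diff_divide_distrib right_diff_distrib)
  also have "\<dots> = (\<Sum>j\<le>k. t k j * (1 + b * Q ^ (2 * j)) / Q ^ j * \<phi> j) - (\<Sum>j\<le>k. t k j / Q ^ j * \<phi> (Suc j))"
    by (rule sum_subtractf)
  also have "(\<Sum>j\<le>k. t k j * (1 + b * Q ^ (2 * j)) / Q ^ j * \<phi> j) =
      (\<Sum>j\<le>Suc k. t k j * (1 + b * Q ^ (2 * j)) / Q ^ j * \<phi> j)"
  proof -
    have "t k (Suc k) = 0"
      unfolding t_def by (simp add: qpoch_neg_power_eq_0)
    then show ?thesis by simp
  qed
  also have "\<dots> = (1 + b) * \<phi> 0 + (\<Sum>j\<le>k. t k (Suc j) * (1 + b * Q ^ (2 * Suc j)) / Q ^ Suc j * \<phi> (Suc j))"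
    by (subst sum.atMost_Suc_shift) (simp add: t0)
  finally have yk: "a * y * ultra k = (1 + b) * \<phi> 0
      + (\<Sum>j\<le>k. (t k (Suc j) * (1 + b * Q ^ (2 * Suc j)) / Q ^ Suc j - t k j / Q ^ j) * \<phi> (Suc j))"
    by (simp add: left_diff_distrib sum_subtractf)
  have uk: "ultra k' = \<phi> 0 + (\<Sum>j\<le>k. t k' (Suc j) * \<phi> (Suc j))" if "k' \<le> Suc k" for k'
    unfolding extend [OF that] \<phi>_def by (subst sum.atMost_Suc_shift) (simp add: t0)
  have "a * y * (1 - b * Q ^ k) * ultra k - b * (1 - Q ^ k) * ultra (k - 1) =
     (1 - b * Q ^ k) * (a * y * ultra k) - b * (1 - Q ^ k) * ultra (k - 1)"
    by simp
  also have "\<dots> = ((1 - b * Q ^ k) * (1 + b) - b * (1 - Q ^ k)) * \<phi> 0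
     + (\<Sum>j\<le>k. ((1 - b * Q ^ k) * (t k (Suc j) * (1 + b * Q ^ (2 * Suc j)) / Q ^ Suc j - t k j / Q ^ j)
        - b * (1 - Q ^ k) * t (k - 1) (Suc j)) * \<phi> (Suc j))"
  proof -
    have lin: "x * (y0 + (\<Sum>j\<le>k. A j * \<phi> (Suc j))) - z * (\<phi> 0 + (\<Sum>j\<le>k. B j * \<phi> (Suc j))) =
        x * y0 - z * \<phi> 0 + (\<Sum>j\<le>k. (x * A j - z * B j) * \<phi> (Suc j))" for x y0 z A B
      by (simp add: distrib_left left_diff_distrib sum_subtractf sum_distrib_left mult.assoc)
    show ?thesis
      unfolding yk uk [of "k - 1", OF le_trans [OF diff_le_self le_SucI [OF order_refl]]] lin
      by (simp only: left_diff_distrib [of "(1 - b * Q ^ k) * (1 + b)"] mult.assoc)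
  qed
  also have "\<dots> = (1 - b\<^sup>2 * Q ^ k) * ultra (Suc k)"
  proof -
    have comm: "u / z * v = v * u / z" for u z v :: complex
      by simp
    have "(\<Sum>j\<le>k. ((1 - b * Q ^ k) * (t k (Suc j) * (1 + b * Q ^ (2 * Suc j)) / Q ^ Suc j - t k j / Q ^ j)
        - b * (1 - Q ^ k) * t (k - 1) (Suc j)) * \<phi> (Suc j)) = (\<Sum>j\<le>k. (1 - b\<^sup>2 * Q ^ k) * t (Suc k) (Suc j) * \<phi> (Suc j))"
      by (rule sum.cong [OF refl]) (simp only: coeff [unfolded comm] atMost_iff)
    then show ?thesis
      unfolding coeff0 [symmetric] uk [OF order_refl] by (simp only: distrib_left sum_distrib_left mult.assoc)
  qed
  finally show ?thesis
    by (simp add: b_def)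
qed

end

subsection \<open>Expansion of the Askey-Wilson basis\<close>

context
  fixes a y :: complex
begin

text \<open>For \<open>a\<^sup>4 q\<^sup>k \<noteq> 1\<close> this is \<open>(1 + a\<^sup>2) (1 - a\<^sup>2 q\<^sup>k) (a\<^sup>4 q; q)\<^sub>k / (1 - a\<^sup>4 q\<^sup>k)\<close>; writing it without a
  denominator keeps the case \<open>a\<^sup>2 = 1\<close>, which the identity for \<open>aw_p\<close> includes.\<close>

definition ultra_factor :: "nat \<Rightarrow> complex" where
  "ultra_factor k = (if k = 0 then 1 else (1 + a\<^sup>2) * (1 - a\<^sup>2 * Q ^ k) * poch (a ^ 4 * Q) (k - 1))"

text \<open>For nonzero \<open>a\<close> with a^2 different from 1 this is (1 - a^2 q^k) / (1 - a^2)
  times the Rogers polynomial C_k(y/2; a^2 | q).\<close>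

definition ultra_scaled :: "nat \<Rightarrow> complex" where
  "ultra_scaled k = ultra_factor k * ultra a y k / (poch Q k * a ^ k)"

text \<open>Note that \<open>up_coeff 0 = 0\<close> also for \<open>a\<^sup>2 = 1\<close>, where the quotient is \<open>0 / 0\<close>.\<close>

definition up_coeff :: "nat \<Rightarrow> complex" where
  "up_coeff k = (1 - Q ^ k) / (1 - a\<^sup>2 * Q ^ k)"

definition down_coeff :: "nat \<Rightarrow> complex" where
  "down_coeff k = (if k = 0 then 1 + a\<^sup>2 else (1 - a ^ 4 * Q ^ k) / (1 - a\<^sup>2 * Q ^ k))"

lemma ultra_scaled_recurrence:
  assumes nz: "ultra_denom a (Suc k) \<noteq> 0" and a: "a \<noteq> 0" and b: "poch (a\<^sup>2 * Q) (Suc k) \<noteq> 0"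
  shows "y * ultra_scaled k = up_coeff (Suc k) * ultra_scaled (Suc k)
     + (if k = 0 then 0 else down_coeff (k - 1) * ultra_scaled (k - 1))"
proof (cases k)
  case 0
  have nz': "1 + a\<^sup>2 \<noteq> 0" "1 - a ^ 4 * Q \<noteq> 0"
    using nz unfolding 0 ultra_denom_Suc by auto
  have b': "a\<^sup>2 * Q \<noteq> 1"
    using b by (simp add: 0 qpoch_def)
  \<comment> \<open>The first polynomial is computed from its series, since
    \<open>ultra_recurrence\<close> at k = 0 reads 0 = 0 when a^2 = 1.\<close>
  have u1: "ultra a y 1 = a * y / (1 + a\<^sup>2)"
  proof -
    have "ultra_denom a 1 = (1 - Q) * (1 + a\<^sup>2) * (1 - a ^ 4 * Q)"
      using ultra_denom_Suc [of 0 a] by simp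
    moreover have "ultra a y 1 = 1 + poch (1 / Q) 1 * poch (a ^ 4 * Q) 1 * Q / ultra_denom a 1 * aw_basis a y 1"
      by (simp add: ultra_def power_int_minus divide_inverse)
    ultimately have "ultra a y 1 = 1 + (1 - 1 / Q) * (1 - a ^ 4 * Q) * Q / ((1 - Q) * (1 + a\<^sup>2) * (1 - a ^ 4 * Q)) * (1 - a * y + a\<^sup>2)"
      by (simp only:) (simp add: qpoch_def aw_basis_def)
    also have "\<dots> = 1 + ((1 - 1 / Q) * Q / (1 - Q)) / (1 + a\<^sup>2) * (1 - a * y + a\<^sup>2)"
      using nz' by simp
    also have "(1 - 1 / Q) * Q / (1 - Q) = -1"
      using Q_power_neq_1 [of 0] by (simp add: divide_simps del: Q_power_neq_1)
    also have "1 + -1 / (1 + a\<^sup>2) * (1 - a * y + a\<^sup>2) = a * y / (1 + a\<^sup>2)"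
      using nz' by (simp add: divide_simps)
    finally show ?thesis .
  qed
  have "ultra a y 0 = 1"
    by (simp add: ultra_def)
  moreover have "1 - Q \<noteq> 0"
    using Q_power_neq_1 [of 0] by (simp del: Q_power_neq_1)
  ultimately show ?thesis
    using a nz' b' u1 by (simp add: 0 ultra_scaled_def ultra_factor_def up_coeff_def qpoch_def)
next
  case (Suc k')
  define b where "b = a\<^sup>2"
  have b4: "a ^ 4 = b\<^sup>2"
    by (simp add: b_def)
  have "poch (b * Q) (Suc k') \<noteq> 0" 
    using b qpoch_nonzero_mono [of "b * Q" q "Suc k" "Suc k'"] unfolding b_def Suc by simp
  then have k': "1 - b * Q ^ Suc k' \<noteq> 0"
    by (simp add: qpoch_Suc mult_ac)
  have k: "1 - b * Q ^ Suc k \<noteq> 0"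
    using b unfolding b_def by (simp add: qpoch_Suc mult_ac)
  define P where "P = (1 + b) * poch (b\<^sup>2 * Q) k'"
  have "poch (b\<^sup>2 * Q) k = poch (b\<^sup>2 * Q) k' * (1 - b\<^sup>2 * Q ^ k)"
    by (simp add: Suc qpoch_Suc mult_ac)
  then have "up_coeff (Suc k) * ultra_scaled (Suc k) =
     P * ((1 - a ^ 4 * Q ^ k) * ultra a y (Suc k)) / (poch Q k * a ^ Suc k)"
    using k unfolding up_coeff_def ultra_scaled_def ultra_factor_def b4 b_def [symmetric] P_def
    by (simp add: qpoch_Suc mult_ac)
  also have "\<dots> = P * (1 - b * Q ^ k) * y * ultra a y k / (poch Q k * a ^ k)
      - P * b * (1 - Q ^ k) * ultra a y k' / (poch Q k * a ^ Suc k)"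
    unfolding ultra_recurrence [OF nz a] b_def [symmetric] using a
    by (simp add: Suc right_diff_distrib diff_divide_distrib mult_ac)
  also have "P * (1 - b * Q ^ k) * y * ultra a y k / (poch Q k * a ^ k) = y * ultra_scaled k"
    unfolding ultra_scaled_def ultra_factor_def P_def b4 b_def [symmetric] by (simp add: Suc mult_ac)
  also have "P * b * (1 - Q ^ k) * ultra a y k' / (poch Q k * a ^ Suc k) = P * ultra a y k' / (poch Q k' * a ^ k')"
    using a by (simp add: Suc qpoch_Suc b_def power2_eq_square)
  also have "\<dots> = down_coeff k' * ultra_scaled k'"
  proof (cases k')
    case 0
    then show ?thesis
      by (simp add: P_def down_coeff_def ultra_scaled_def ultra_factor_def b_def)
  next
    case (Suc k'')
    have "poch (b * Q) (Suc k'') \<noteq> 0" 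
      using b qpoch_nonzero_mono [of "b * Q" q "Suc k" "Suc k''"] unfolding b_def \<open>k = Suc k'\<close> Suc by simp
    then have "1 - b * Q ^ k' \<noteq> 0"
      by (simp add: Suc qpoch_Suc mult_ac)
    moreover have "P = (1 + b) * (poch (b\<^sup>2 * Q) k'' * (1 - b\<^sup>2 * Q ^ k'))"
      by (simp add: P_def Suc qpoch_Suc mult_ac)
    ultimately show ?thesis
      unfolding down_coeff_def ultra_scaled_def ultra_factor_def b4 b_def [symmetric] by (simp add: Suc mult_ac)
  qed
  finally show ?thesis
    by (simp add: Suc)
qed

text \<open>The coefficient of w^(k+2i) times \<open>ultra_scaled k\<close> in the basis function of
  index k + i + l. The slack \<open>l\<close> serves as an index so that the support condition is
  automatic.\<close>

definition conn_coeff :: "nat \<Rightarrow> nat \<Rightarrow> nat \<Rightarrow> complex" where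
  "conn_coeff k i l = (-1) ^ k * Q ^ ((k + i) choose 2) * Q ^ (i choose 2)
     * (poch Q (k + i + l) * poch (a\<^sup>2 * Q) (k + i + l))
     / (poch Q i * poch (a\<^sup>2 * Q) (k + l) * poch Q l * poch (a\<^sup>2 * Q) (k + i))"

definition triples :: "nat \<Rightarrow> (nat \<times> nat \<times> nat) set" where
  "triples j = {(k, i, l). k + i + l = j}"

lemma finite_triples [simp]: "finite (triples j)"
proof (rule finite_subset)
  show "triples j \<subseteq> {..j} \<times> {..j} \<times> {..j}"
    by (auto simp: triples_def)
qed auto

text \<open>The four terms belong to the four ways of reaching (k, i, l) from the previous level:
  from (k, i, l - 1), (k - 1, i, l), (k + 1, i - 1, l - 1) and (k, i - 1, l). They arise from 1, the
  upper and lower parts of multiplication by \<open>y\<close>, and w^2 q^(2j) in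
  \<open>aw_basis_Suc\<close>.\<close>

lemma conn_coeff_split:
  assumes j: "k + i + l = Suc j" and nz: "poch (a\<^sup>2 * Q) (Suc j) \<noteq> 0"
  shows "(1 - Q ^ Suc j) * (1 - a\<^sup>2 * Q ^ Suc j) =
     (1 - Q ^ l) * (1 - a\<^sup>2 * Q ^ (k + l)) + Q ^ l * up_coeff k * (1 - a\<^sup>2 * Q ^ (k + l)) * (1 - a\<^sup>2 * Q ^ (k + i))
     + Q ^ (k + l) * down_coeff k * (1 - Q ^ i) * (1 - Q ^ l) + Q ^ (k + 2 * l) * (1 - Q ^ i) * (1 - a\<^sup>2 * Q ^ (k + i))"
\<comment> \<open>For k = 0 the coefficients are 0 and 1 + a^2, so no division by 1 - a^2
  occurs.\<close>
proof (cases k)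
  case 0
  show ?thesis
    unfolding j [symmetric] up_coeff_def down_coeff_def
    by (simp add: 0 power_double power_add) (simp add: algebra_simps)
next
  case (Suc k')
  have "poch (a\<^sup>2 * Q) (Suc k') \<noteq> 0"
    using nz j Suc qpoch_nonzero_mono [of "a\<^sup>2 * Q" q "Suc j" "Suc k'"] by simp
  then have k: "1 - a\<^sup>2 * Q ^ k \<noteq> 0"
    by (simp add: Suc qpoch_Suc mult_ac)
  define K I L where "K = Q ^ k" and "I = Q ^ i" and "L = Q ^ l"
  have "Q ^ Suc j = K * I * L" "Q ^ (k + l) = K * L" "Q ^ (k + i) = K * I" "Q ^ (k + 2 * l) = K * L * L"
    unfolding j [symmetric] K_def I_def L_def by (simp_all add: power_double power_add)
  then show ?thesis
    using k unfolding up_coeff_def down_coeff_def K_def [symmetric] I_def [symmetric] L_def [symmetric]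
    by (simp add: Suc divide_simps) (simp add: algebra_simps power2_eq_square power4_eq_xxxx)
qed

text \<open>Induction on \<open>j\<close>, run backwards: the sum at level j + 1 is split by
  \<open>conn_coeff_split\<close>, each part is moved to level \<open>j\<close>, and
  \<open>ultra_scaled_recurrence\<close> reassembles the factor 1 - w y q^j + w^2 q^(2j).\<close>

lemma aw_basis_expansion:
  assumes nz: "ultra_denom a n \<noteq> 0" and a: "a \<noteq> 0" and b: "poch (a\<^sup>2 * Q) n \<noteq> 0" and "j \<le> n"
  shows "aw_basis w y j = (\<Sum>(k, i, l)\<in>triples j. conn_coeff k i l * w ^ (k + 2 * i) * ultra_scaled k)"
  using \<open>j \<le> n\<close>
proof (induction j)
  case 0
  have "triples 0 = {(0, 0, 0)}"
    by (auto simp: triples_def)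
  then show ?case
    by (simp add: conn_coeff_def ultra_scaled_def ultra_factor_def ultra_def)
next
  case (Suc j)
  have nzb: "poch (a\<^sup>2 * Q) k \<noteq> 0" if "k \<le> Suc j" for k
    using qpoch_nonzero_mono [OF b, of k] that Suc.prems by simp
  have nzb1: "1 - a\<^sup>2 * Q ^ k \<noteq> 0" if "k \<le> Suc j" "k \<noteq> 0" for k
    using nzb [of k] that by (cases k) (auto simp: qpoch_Suc mult_ac)
  have nzu: "ultra_denom a k \<noteq> 0" if "k \<le> Suc j" for k
  proof -
    have "k \<le> n"
      using that Suc.prems by simp
    then show ?thesis
      using nz qpoch_nonzero_mono [of _ q n k] by auto
  qed
  define D where "D = (1 - Q ^ Suc j) * (1 - a\<^sup>2 * Q ^ Suc j)"
  have D: "D \<noteq> 0"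
    unfolding D_def using nzb1 [of "Suc j"] by simp
  define t where "t k i l = conn_coeff k i l * w ^ (k + 2 * i) * ultra_scaled k" for k i l
  define F1 where "F1 k i l = t k i l * ((1 - Q ^ l) * (1 - a\<^sup>2 * Q ^ (k + l)) / D)" for k i l
  define F2 where "F2 k i l = t k i l * (Q ^ l * up_coeff k * (1 - a\<^sup>2 * Q ^ (k + l)) * (1 - a\<^sup>2 * Q ^ (k + i)) / D)" for k i l
  define F3 where "F3 k i l = t k i l * (Q ^ (k + l) * down_coeff k * (1 - Q ^ i) * (1 - Q ^ l) / D)" for k i l
  define F4 where "F4 k i l = t k i l * (Q ^ (k + 2 * l) * (1 - Q ^ i) * (1 - a\<^sup>2 * Q ^ (k + i)) / D)" for k i l
  define d where "d k = (if k = 0 then 0 else down_coeff (k - 1) * ultra_scaled (k - 1))" for k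
  have "(\<Sum>(k, i, l)\<in>triples (Suc j). t k i l) = (\<Sum>(k, i, l)\<in>triples (Suc j). F1 k i l + F2 k i l + F3 k i l + F4 k i l)"
  proof (rule sum.cong [OF refl], clarify)
    fix k i l assume "(k, i, l) \<in> triples (Suc j)"
    then have "k + i + l = Suc j"
      by (simp add: triples_def)
    note conn_coeff_split [OF this nzb [OF order_refl], folded D_def]
    then have "t k i l * (D / D) = F1 k i l + F2 k i l + F3 k i l + F4 k i l"
      unfolding F1_def F2_def F3_def F4_def by (simp only: add_divide_distrib distrib_left)
    then show "t k i l = F1 k i l + F2 k i l + F3 k i l + F4 k i l"
      using D by simp
  qed
  also have "\<dots> = (\<Sum>(k, i, l)\<in>triples (Suc j). F1 k i l) + (\<Sum>(k, i, l)\<in>triples (Suc j). F2 k i l)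
      + (\<Sum>(k, i, l)\<in>triples (Suc j). F3 k i l) + (\<Sum>(k, i, l)\<in>triples (Suc j). F4 k i l)"
    by (simp add: case_prod_unfold sum.distrib)
  \<comment> \<open>The triples with l = 0 have no preimage at level \<open>j\<close>, but there 1 -
    q^l is 0. The sums of \<open>F4\<close> and \<open>F2\<close> are moved likewise, with i = 0 and
    k = 0 as boundary.\<close>
  also have "(\<Sum>(k, i, l)\<in>triples (Suc j). F1 k i l) = (\<Sum>(k, i, l)\<in>triples j. t k i l)"
  proof (rule sum.reindex_bij_witness_not_neutral [symmetric, where S' = "{}" and T' = "{(k, i, l) \<in> triples (Suc j). l = 0}"
        and i = "\<lambda>(k, i, l). (k, i, l - 1)" and j = "\<lambda>(k, i, l). (k, i, Suc l)"])
    show "finite {(k, i, l) \<in> triples (Suc j). l = 0}"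
      by (rule finite_subset [OF _ finite_triples [of "Suc j"]]) auto
    fix x assume x: "x \<in> triples j"
    obtain k i l where x': "x = (k, i, l)" by (cases x)
    have N: "k + i + l = j"
      using x by (simp add: x' triples_def)
    have nzs: "poch (a\<^sup>2 * Q) (k + l) \<noteq> 0" "poch (a\<^sup>2 * Q) (k + i) \<noteq> 0" "1 - a\<^sup>2 * Q ^ Suc (k + l) \<noteq> 0"
      by (rule nzb, use N in simp, rule nzb, use N in simp, rule nzb1, use N in simp, simp)
    have "conn_coeff k i (Suc l) = conn_coeff k i l * D / ((1 - Q ^ Suc l) * (1 - a\<^sup>2 * Q ^ Suc (k + l)))"
      unfolding conn_coeff_def D_def N [symmetric] power_add power_double using nzs by (simp add: qpoch_Suc mult_ac)
    then show "(case (case x of (k, i, l) \<Rightarrow> (k, i, Suc l)) of (k, i, l) \<Rightarrow> F1 k i l) = (case x of (k, i, l) \<Rightarrow> t k i l)"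
      using nzs D by (simp add: x' F1_def t_def)
  qed (auto simp: triples_def F1_def)
  also have "(\<Sum>(k, i, l)\<in>triples (Suc j). F4 k i l) = (\<Sum>(k, i, l)\<in>triples j. w\<^sup>2 * Q ^ (2 * j) * t k i l)"
  proof (rule sum.reindex_bij_witness_not_neutral [symmetric, where S' = "{}" and T' = "{(k, i, l) \<in> triples (Suc j). i = 0}"
        and i = "\<lambda>(k, i, l). (k, i - 1, l)" and j = "\<lambda>(k, i, l). (k, Suc i, l)"])
    show "finite {(k, i, l) \<in> triples (Suc j). i = 0}"
      by (rule finite_subset [OF _ finite_triples [of "Suc j"]]) auto
    fix x assume x: "x \<in> triples j"
    obtain k i l where x': "x = (k, i, l)" by (cases x)
    have N: "k + i + l = j"
      using x by (simp add: x' triples_def)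
    have nzs: "poch (a\<^sup>2 * Q) (k + l) \<noteq> 0" "poch (a\<^sup>2 * Q) (k + i) \<noteq> 0" "1 - a\<^sup>2 * Q ^ Suc (k + i) \<noteq> 0"
      by (rule nzb, use N in simp, rule nzb, use N in simp, rule nzb1, use N in simp, simp)
    have "conn_coeff k (Suc i) l = conn_coeff k i l * D * Q ^ (k + 2 * i) / ((1 - Q ^ Suc i) * (1 - a\<^sup>2 * Q ^ Suc (k + i)))"
      unfolding conn_coeff_def D_def N [symmetric] power_add power_double using nzs by (simp add: qpoch_Suc Suc_choose_2 power_double power_add mult_ac)
    moreover have "Q ^ (2 * j) = Q ^ (k + 2 * i) * Q ^ (k + 2 * l)"
      unfolding N [symmetric] by (simp add: add_ac flip: power_add)
    ultimately show "(case (case x of (k, i, l) \<Rightarrow> (k, Suc i, l)) of (k, i, l) \<Rightarrow> F4 k i l) = (case x of (k, i, l) \<Rightarrow> w\<^sup>2 * Q ^ (2 * j) * t k i l)"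
      using nzs D by (simp add: x' F4_def t_def power2_eq_square mult_ac)
  qed (auto simp: triples_def F4_def)
  also have "(\<Sum>(k, i, l)\<in>triples (Suc j). F2 k i l) =
      (\<Sum>(k, i, l)\<in>triples j. - (w * Q ^ j) * (conn_coeff k i l * w ^ (k + 2 * i)) * (up_coeff (Suc k) * ultra_scaled (Suc k)))"
  proof (rule sum.reindex_bij_witness_not_neutral [symmetric, where S' = "{}" and T' = "{(k, i, l) \<in> triples (Suc j). k = 0}"
        and i = "\<lambda>(k, i, l). (k - 1, i, l)" and j = "\<lambda>(k, i, l). (Suc k, i, l)"])
    show "finite {(k, i, l) \<in> triples (Suc j). k = 0}"
      by (rule finite_subset [OF _ finite_triples [of "Suc j"]]) auto
    fix x assume x: "x \<in> triples j"
    obtain k i l where x': "x = (k, i, l)" by (cases x)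
    have N: "k + i + l = j"
      using x by (simp add: x' triples_def)
    have nzs: "poch (a\<^sup>2 * Q) (k + l) \<noteq> 0" "poch (a\<^sup>2 * Q) (k + i) \<noteq> 0" "1 - a\<^sup>2 * Q ^ Suc (k + i) \<noteq> 0" "1 - a\<^sup>2 * Q ^ Suc (k + l) \<noteq> 0"
      by (rule nzb, use N in simp, rule nzb, use N in simp, rule nzb1, use N in simp, simp, rule nzb1, use N in simp, simp)
    have "conn_coeff (Suc k) i l = - (conn_coeff k i l * D * Q ^ (k + i) / ((1 - a\<^sup>2 * Q ^ Suc (k + l)) * (1 - a\<^sup>2 * Q ^ Suc (k + i))))"
      unfolding conn_coeff_def D_def N [symmetric] power_add power_double using nzs by (simp add: qpoch_Suc Suc_choose_2 power_double power_add mult_ac)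
    moreover have "Q ^ j = Q ^ (k + i) * Q ^ l"
      unfolding N [symmetric] by (simp flip: power_add)
    ultimately show "(case (case x of (k, i, l) \<Rightarrow> (Suc k, i, l)) of (k, i, l) \<Rightarrow> F2 k i l) =
        (case x of (k, i, l) \<Rightarrow> - (w * Q ^ j) * (conn_coeff k i l * w ^ (k + 2 * i)) * (up_coeff (Suc k) * ultra_scaled (Suc k)))"
      using nzs D by (simp add: x' F2_def t_def mult_ac)
  qed (auto simp: triples_def F2_def up_coeff_def)
  also have "(\<Sum>(k, i, l)\<in>triples (Suc j). F3 k i l) =
      (\<Sum>(k, i, l)\<in>triples j. - (w * Q ^ j) * (conn_coeff k i l * w ^ (k + 2 * i)) * d k)"
  proof -
    \<comment> \<open>Here both sides have a boundary: \<open>F3\<close> vanishes for i = 0 or l =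
      0, and the target has no contribution from k = 0.\<close>
    have "(\<Sum>(k, i, l)\<in>triples (Suc j). F3 k i l) = (\<Sum>(k, i, l)\<in>{(k, i, l) \<in> triples (Suc j). i > 0 \<and> l > 0}. F3 k i l)"
      by (rule sum.mono_neutral_right) (auto simp: F3_def intro!: gr0I)
    also have "\<dots> = (\<Sum>(k, i, l)\<in>{(k, i, l) \<in> triples j. k > 0}. - (w * Q ^ j) * (conn_coeff k i l * w ^ (k + 2 * i)) * d k)"
    proof (rule sum.reindex_bij_witness [symmetric, where i = "\<lambda>(k, i, l). (Suc k, i - 1, l - 1)" and j = "\<lambda>(k, i, l). (k - 1, Suc i, Suc l)"])
      fix x assume x: "x \<in> {(k, i, l) \<in> triples j. k > 0}"
      obtain k i l where x': "x = (Suc k, i, l)"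
        using x gr0_conv_Suc by (cases x) auto
      have N: "Suc k + i + l = j"
        using x by (simp add: x' triples_def)
      have nzs: "poch (a\<^sup>2 * Q) (Suc (k + l)) \<noteq> 0" "poch (a\<^sup>2 * Q) (Suc (k + i)) \<noteq> 0"
        by (rule nzb, use N in simp, rule nzb, use N in simp)
      have "conn_coeff k (Suc i) (Suc l) = - (conn_coeff (Suc k) i l * D * Q ^ i / ((1 - Q ^ Suc l) * (1 - Q ^ Suc i)))"
        unfolding conn_coeff_def D_def N [symmetric] power_add power_double using nzs by (simp add: qpoch_Suc Suc_choose_2 power_double power_add mult_ac)
      moreover have "Q ^ j = Q ^ i * Q ^ (k + Suc l)"
        unfolding N [symmetric] by (simp add: add_ac flip: power_add power_Suc)
      ultimately show "(case (case x of (k, i, l) \<Rightarrow> (k - 1, Suc i, Suc l)) of (k, i, l) \<Rightarrow> F3 k i l) =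
          (case x of (k, i, l) \<Rightarrow> - (w * Q ^ j) * (conn_coeff k i l * w ^ (k + 2 * i)) * d k)"
        using D by (simp add: x' F3_def t_def d_def mult_ac)
    qed (auto simp: triples_def)
    also have "\<dots> = (\<Sum>(k, i, l)\<in>triples j. - (w * Q ^ j) * (conn_coeff k i l * w ^ (k + 2 * i)) * d k)"
      by (rule sum.mono_neutral_left) (auto simp: d_def intro!: gr0I)
    finally show ?thesis .
  qed
  finally have "(\<Sum>(k, i, l)\<in>triples (Suc j). t k i l) =
      (\<Sum>(k, i, l)\<in>triples j. t k i l - (w * Q ^ j) * (conn_coeff k i l * w ^ (k + 2 * i)) * (up_coeff (Suc k) * ultra_scaled (Suc k) + d k)
        + w\<^sup>2 * Q ^ (2 * j) * t k i l)"
    by (simp add: case_prod_unfold sum.distrib [symmetric] algebra_simps)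
  also have "\<dots> = (\<Sum>(k, i, l)\<in>triples j. (1 - w * y * Q ^ j + w\<^sup>2 * Q ^ (2 * j)) * t k i l)"
  proof (rule sum.cong [OF refl], clarify)
    fix k i l assume "(k, i, l) \<in> triples j"
    then have kj: "Suc k \<le> Suc j"
      by (simp add: triples_def)
    have "up_coeff (Suc k) * ultra_scaled (Suc k) + d k = y * ultra_scaled k"
      unfolding d_def by (rule ultra_scaled_recurrence [OF nzu [OF kj] a nzb [OF kj], symmetric])
    then show "t k i l - (w * Q ^ j) * (conn_coeff k i l * w ^ (k + 2 * i)) * (up_coeff (Suc k) * ultra_scaled (Suc k) + d k)
        + w\<^sup>2 * Q ^ (2 * j) * t k i l = (1 - w * y * Q ^ j + w\<^sup>2 * Q ^ (2 * j)) * t k i l"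
      by (simp add: t_def algebra_simps)
  qed
  also have "\<dots> = (1 - w * y * Q ^ j + w\<^sup>2 * Q ^ (2 * j)) * (\<Sum>(k, i, l)\<in>triples j. t k i l)"
    by (simp add: case_prod_unfold sum_distrib_left)
  also have "(\<Sum>(k, i, l)\<in>triples j. t k i l) = aw_basis w y j"
    using Suc unfolding t_def by simp
  finally show ?case
    unfolding t_def aw_basis_Suc by simp
qed

end

subsection \<open>The addition formula\<close>

lemma poch_Q_inverse_shift:
  assumes "k + J \<le> n"
  shows "poch (Q powi (- int n)) (k + J) = poch (Q powi (- int n)) k * poch (Q powi (- int (n - k))) J"
proof -
  have n: "n = k + (n - k)"
    using assms by simp
  have "Q powi (- int n) * Q ^ k = inverse (Q ^ (k + (n - k))) * Q ^ k"
    unfolding power_int_minus power_int_of_nat using n by simp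
  also have "\<dots> = Q powi (- int (n - k))"
    unfolding power_int_minus power_int_of_nat power_add by simp
  finally show ?thesis
    unfolding qpoch_add by simp
qed

lemma phi22_eq_jackson22:
  assumes "k \<le> n"
  shows "phi22 (Q powi (int k - int n)) g c (c * Y) q (Q * Y) = jackson22 (n - k) (Q powi (- int (n - k))) g c Y"
proof -
  have 1: "int k - int n = - int (n - k)"
    using assms by simp
  show ?thesis
    unfolding jackson22_def 1 phi22_terminates [OF q_nonzero]
    by (simp add: qpochs_def choose_two mult_ac)
qed

text \<open>Inserting \<open>aw_basis_expansion\<close> and collecting the terms with fixed
  \<open>k\<close> leaves \<open>product_sum\<close> with m = n - k and c = a^2 q^(k+1), which
  \<open>jackson22_product\<close> factors.\<close>

lemma aw_connection:
  fixes a w y X Y :: complex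
  assumes a: "a \<noteq> 0" and w: "w\<^sup>2 = a\<^sup>2 * Q * X * Y"
    and nz: "ultra_denom a n \<noteq> 0" and b: "poch (a\<^sup>2 * Q) n \<noteq> 0"
    and X: "poch (a\<^sup>2 * Q * X) n \<noteq> 0" and Y: "poch (a\<^sup>2 * Q * Y) n \<noteq> 0"
  shows "(\<Sum>j\<le>n. poch (Q powi (- int n)) j * poch (a ^ 4 * Q ^ (n + 1)) j * Q ^ j
      / (poch (a\<^sup>2 * Q) j * poch (a\<^sup>2 * Q * X) j * poch (a\<^sup>2 * Q * Y) j * poch Q j) * aw_basis w y j) =
    (-1) ^ n * a ^ (2 * n) * Q ^ (Suc n choose 2) *
    (\<Sum>k\<le>n. poch (Q powi (- int n)) k * poch (a ^ 4 * Q ^ (n + 1)) k * (w / a ^ 3) ^ k * ultra_factor a k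
        / (poch Q k * (poch (a\<^sup>2 * Q) k)\<^sup>2 * poch (a\<^sup>2 * Q * X) k * poch (a\<^sup>2 * Q * Y) k)
      * phi22 (Q powi (int k - int n)) (a ^ 4 * Q ^ (n + k + 1)) (a\<^sup>2 * Q ^ (k + 1)) (a\<^sup>2 * Q ^ (k + 1) * X) q (Q * X)
      * phi22 (Q powi (int k - int n)) (a ^ 4 * Q ^ (n + k + 1)) (a\<^sup>2 * Q ^ (k + 1)) (a\<^sup>2 * Q ^ (k + 1) * Y) q (Q * Y)
      * ultra a y k)"
proof -
  define b where "b = a\<^sup>2"
  have b4: "a ^ 4 = b\<^sup>2"
    by (simp add: b_def)
  define e where "e m = Q powi (- int m)" for m
  define g where "g = b\<^sup>2 * Q ^ (n + 1)"
  define E where "E = ultra_scaled a y"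
  define c where "c k = b * Q ^ (k + 1)" for k
  define W where "W k i l = poch (e n) (k + i + l) * poch g (k + i + l) * Q ^ (k + i + l)
      / (poch (b * Q) (k + i + l) * poch (b * Q * X) (k + i + l) * poch (b * Q * Y) (k + i + l) * poch Q (k + i + l))
      * (conn_coeff a k i l * w ^ (k + 2 * i) * E k)" for k i l
  have bnz: "poch (b * Q) k \<noteq> 0" if "k \<le> n" for k
    using qpoch_nonzero_mono b that unfolding b_def by blast
  have "(\<Sum>j\<le>n. poch (e n) j * poch g j * Q ^ j
      / (poch (b * Q) j * poch (b * Q * X) j * poch (b * Q * Y) j * poch Q j) * aw_basis w y j) =
     (\<Sum>j\<le>n. \<Sum>(k, i, l)\<in>triples j. W k i l)"
  proof (rule sum.cong [OF refl])
    fix j assume "j \<in> {..n}"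
    then have j: "j \<le> n" by simp
    show "poch (e n) j * poch g j * Q ^ j
      / (poch (b * Q) j * poch (b * Q * X) j * poch (b * Q * Y) j * poch Q j) * aw_basis w y j = (\<Sum>(k, i, l)\<in>triples j. W k i l)"
      unfolding aw_basis_expansion [OF nz a b j] sum_distrib_left
      by (rule sum.cong) (auto simp: triples_def W_def E_def)
  qed
  also have "\<dots> = (\<Sum>(j, k, i, l)\<in>(SIGMA j:{..n}. triples j). W k i l)"
    by (simp add: sum.Sigma)
  \<comment> \<open>The new index is J = i + l, so that j = k + J.\<close>
  also have "\<dots> = (\<Sum>(k, J, i)\<in>(SIGMA k:{..n}. SIGMA J:{..n - k}. {..J}). W k i (J - i))"
    by (rule sum.reindex_bij_witness [where i = "\<lambda>(k, J, i). (k + J, k, i, J - i)" and j = "\<lambda>(j, k, i, l). (k, i + l, i)"])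
      (auto simp: triples_def)
  also have "\<dots> = (\<Sum>k\<le>n. \<Sum>J\<le>n - k. \<Sum>i\<le>J. W k i (J - i))"
    by (simp add: sum.Sigma)
  also have "\<dots> = (\<Sum>k\<le>n. poch (e n) k * poch g k * Q ^ k * (-1) ^ k * Q ^ (k choose 2) * w ^ k * E k
       / ((poch (b * Q) k)\<^sup>2 * poch (b * Q * X) k * poch (b * Q * Y) k)
       * product_sum (n - k) (e (n - k)) (g * Q ^ k) (c k) X Y)"
  proof (rule sum.cong [OF refl])
    fix k assume "k \<in> {..n}"
    then have k: "k \<le> n" by simp
    show "(\<Sum>J\<le>n - k. \<Sum>i\<le>J. W k i (J - i)) = poch (e n) k * poch g k * Q ^ k * (-1) ^ k * Q ^ (k choose 2) * w ^ k * E k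
       / ((poch (b * Q) k)\<^sup>2 * poch (b * Q * X) k * poch (b * Q * Y) k)
       * product_sum (n - k) (e (n - k)) (g * Q ^ k) (c k) X Y"
      unfolding product_sum_def sum_distrib_left
    proof (intro sum.cong [OF refl])
      fix J i assume "J \<in> {..n - k}" "i \<in> {..J}"
      then have J: "J \<le> n - k" "k + J \<le> n" and i: "i \<le> J" using k by auto
      define l where "l = J - i"
      have l: "J = i + l" using i by (simp add: l_def)
      have ck: "c k = b * Q * Q ^ k"
        by (simp add: c_def mult_ac)
      have s1: "poch (e n) (k + J) = poch (e n) k * poch (e (n - k)) J"
        unfolding e_def by (rule poch_Q_inverse_shift [OF J(2)])
      have s2: "poch (b * Q) (k + r) = poch (b * Q) k * poch (c k) r" for r
        unfolding ck qpoch_add ..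
      have s3: "poch (b * Q * Z) (k + J) = poch (b * Q * Z) k * poch (c k * Z) J" for Z
        unfolding ck qpoch_add by (simp add: mult_ac)
      have tri: "Q ^ ((k + i) choose 2) * Q ^ (i choose 2) = Q ^ (k choose 2) * Q ^ (i * k) * Q ^ (i * (i - 1))"
        unfolding add_choose_2 double_choose_2 [symmetric] power_add by simp
      have "w ^ (2 * i) = (b * Q * X * Y) ^ i"
        unfolding power_mult w b_def ..
      \<comment> \<open>The relation between w^2 and X Y produces the argument c X Y of the product
        formula.\<close>
      then have wi: "Q ^ (i * k) * w ^ (2 * i) = (c k * X * Y) ^ i"
        unfolding ck by (simp add: power_mult_distrib power_mult [symmetric] mult_ac)
      have nzs: "poch (b * Q) (k + J) \<noteq> 0" "poch (b * Q) k \<noteq> 0"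
        using bnz J by auto
      have kil: "k + i + l = k + J"
        by (simp add: l)
      have cancel: "A / (B * x * z * C) * (D * (C * B) / F * G * H) = A / (x * z) * (D / F * G * H)"
        if "B \<noteq> 0" "C \<noteq> 0" for A B C D F G H x z :: complex
        using that by simp
      have "W k i (J - i) = poch (e n) (k + J) * poch g (k + J) * Q ^ (k + J)
         / (poch (b * Q) (k + J) * poch (b * Q * X) (k + J) * poch (b * Q * Y) (k + J) * poch Q (k + J))
         * ((-1) ^ k * Q ^ ((k + i) choose 2) * Q ^ (i choose 2) * (poch Q (k + J) * poch (b * Q) (k + J))
           / (poch Q i * poch (b * Q) (k + l) * poch Q l * poch (b * Q) (k + i)) * (w ^ k * w ^ (2 * i)) * E k)"
        unfolding W_def conn_coeff_def l_def [symmetric] b_def [symmetric] kil power_add [of w] ..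
      also have "\<dots> = poch (e n) (k + J) * poch g (k + J) * Q ^ (k + J) / (poch (b * Q * X) (k + J) * poch (b * Q * Y) (k + J))
         * ((-1) ^ k * Q ^ ((k + i) choose 2) * Q ^ (i choose 2)
           / (poch Q i * poch (b * Q) (k + l) * poch Q l * poch (b * Q) (k + i)) * (w ^ k * w ^ (2 * i)) * E k)"
        by (rule cancel [OF nzs(1) poch_Q_nonzero])
      also have "\<dots> = poch (e n) (k + J) * poch g (k + J) * Q ^ (k + J) / (poch (b * Q * X) (k + J) * poch (b * Q * Y) (k + J))
         * ((-1) ^ k * (Q ^ ((k + i) choose 2) * Q ^ (i choose 2) * w ^ (2 * i))
           / (poch Q i * poch (b * Q) (k + l) * poch Q l * poch (b * Q) (k + i)) * w ^ k * E k)"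
        by (simp only: divide_inverse mult_ac)
      also have "Q ^ ((k + i) choose 2) * Q ^ (i choose 2) * w ^ (2 * i) = Q ^ (k choose 2) * Q ^ (i * (i - 1)) * (c k * X * Y) ^ i"
        unfolding tri wi [symmetric] by (simp only: mult_ac)
      also have "poch (e n) (k + J) * poch g (k + J) * Q ^ (k + J) / (poch (b * Q * X) (k + J) * poch (b * Q * Y) (k + J))
         * ((-1) ^ k * (Q ^ (k choose 2) * Q ^ (i * (i - 1)) * (c k * X * Y) ^ i)
           / (poch Q i * poch (b * Q) (k + l) * poch Q l * poch (b * Q) (k + i)) * w ^ k * E k) =
         poch (e n) k * poch g k * Q ^ k * (-1) ^ k * Q ^ (k choose 2) * w ^ k * E k
       / ((poch (b * Q) k)\<^sup>2 * poch (b * Q * X) k * poch (b * Q * Y) k) *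
         (poch (e (n - k)) J * poch (g * Q ^ k) J * Q ^ J / (poch (c k * X) J * poch (c k * Y) J)
      * (Q ^ (i * (i - 1)) * (c k * X * Y) ^ i / (poch Q i * poch (c k) i * poch Q (J - i) * poch (c k) (J - i))))"
        unfolding s1 s2 s3 qpoch_add [of g] l_def [symmetric] power_add [of Q k J] power2_eq_square [of "poch _ _"]
          divide_inverse inverse_mult_distrib by (simp only: mult_ac)
      finally show "W k i (J - i) = poch (e n) k * poch g k * Q ^ k * (-1) ^ k * Q ^ (k choose 2) * w ^ k * E k
       / ((poch (b * Q) k)\<^sup>2 * poch (b * Q * X) k * poch (b * Q * Y) k) *
         (poch (e (n - k)) J * poch (g * Q ^ k) J * Q ^ J / (poch (c k * X) J * poch (c k * Y) J)
      * (Q ^ (i * (i - 1)) * (c k * X * Y) ^ i / (poch Q i * poch (c k) i * poch Q (J - i) * poch (c k) (J - i))))" .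
    qed
  qed
  also have "\<dots> = (\<Sum>k\<le>n. (-1) ^ n * a ^ (2 * n) * Q ^ (Suc n choose 2) *
      (poch (e n) k * poch g k * (w / a ^ 3) ^ k * ultra_factor a k
        / (poch Q k * (poch (b * Q) k)\<^sup>2 * poch (b * Q * X) k * poch (b * Q * Y) k)
      * phi22 (Q powi (int k - int n)) (b\<^sup>2 * Q ^ (n + k + 1)) (c k) (c k * X) q (Q * X)
      * phi22 (Q powi (int k - int n)) (b\<^sup>2 * Q ^ (n + k + 1)) (c k) (c k * Y) q (Q * Y)
      * ultra a y k))"
  proof (rule sum.cong [OF refl])
    fix k assume "k \<in> {..n}"
    then have k: "k \<le> n" by simp
    define m where "m = n - k"
    have n: "n = k + m" using k by (simp add: m_def)
    have gk: "b\<^sup>2 * Q ^ (n + k + 1) = g * Q ^ k"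
      by (simp add: g_def power_add)
    have ck: "c k = b * Q * Q ^ k"
      by (simp add: c_def mult_ac)
    have s2: "poch (b * Q * Z) n = poch (b * Q * Z) k * poch (c k * Z) m" for Z
      unfolding ck n qpoch_add by (simp add: mult_ac)
    have s2': "poch (b * Q) n = poch (b * Q) k * poch (c k) m"
      unfolding ck n qpoch_add ..
    have em: "e m * Q ^ m = 1"
      by (simp add: e_def power_int_minus)
    have "e m * (g * Q ^ k) * Q = (e m * Q ^ m) * (c k)\<^sup>2"
      unfolding g_def c_def n by (simp add: power_add power2_eq_square mult_ac)
    then have eg: "e m * (g * Q ^ k) * Q = (c k)\<^sup>2"
      by (simp add: em)
    have nzs: "poch (c k) m \<noteq> 0" "poch (c k * X) m \<noteq> 0" "poch (c k * Y) m \<noteq> 0"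
      using b X Y unfolding b_def [symmetric] s2 s2' by auto
    note pr = jackson22_product [OF em eg nzs]
    \<comment> \<open>With n = k + m the exponents of \<open>q\<close> add up through binom(n+1, 2)
      = k + binom(k, 2) + (k + 1) m + binom(m, 2).\<close>
    have pow: "Q ^ k * Q ^ (k choose 2) * (c k ^ m * Q ^ (m choose 2)) = b ^ m * Q ^ (Suc n choose 2)"
    proof -
      have "(Suc n choose 2) = k + (k choose 2) + ((k + 1) * m + (m choose 2))"
        unfolding n by (induction m) (simp_all add: Suc_choose_2)
      then show ?thesis
        by (simp add: c_def power_mult_distrib power_add power_mult [symmetric] mult_ac)
    qed
    have an: "a ^ (2 * n) = b ^ m * a ^ (2 * k)"
      unfolding n b_def by (simp add: power_add power_mult)
    \<comment> \<open>The power a^(-k) on the right comes from \<open>ultra_scaled\<close>.\<close>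
    have wk: "a ^ (2 * k) * (w / a ^ 3) ^ k = w ^ k / a ^ k"
    proof -
      have "a ^ 3 = a\<^sup>2 * a"
        by (simp add: power3_eq_cube power2_eq_square)
      then have "a\<^sup>2 * (w / a ^ 3) = w / a"
        using a by simp
      then show ?thesis
        by (simp only: power_mult power_mult_distrib [symmetric] power_divide [symmetric])
    qed
    have sgn: "(-1) ^ k * (- c k) ^ m = (-1) ^ n * c k ^ m"
      unfolding n power_add by (subst power_minus [of "c k"]) simp
    define J where "J = jackson22 m (e m) (g * Q ^ k) (c k) X * jackson22 m (e m) (g * Q ^ k) (c k) Y"
    define Z where "Z = poch (e n) k * poch g k * ultra_factor a k * ultra a y k
        / (poch Q k * (poch (b * Q) k)\<^sup>2 * poch (b * Q * X) k * poch (b * Q * Y) k) * J"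
    have "poch (e n) k * poch g k * Q ^ k * (-1) ^ k * Q ^ (k choose 2) * w ^ k * E k
       / ((poch (b * Q) k)\<^sup>2 * poch (b * Q * X) k * poch (b * Q * Y) k)
       * product_sum m (e m) (g * Q ^ k) (c k) X Y =
      ((-1) ^ k * (- c k) ^ m) * (Q ^ k * Q ^ (k choose 2) * Q ^ (m choose 2)) * (w ^ k / a ^ k) * Z"
      unfolding pr [symmetric] E_def ultra_scaled_def Z_def J_def divide_inverse inverse_mult_distrib
      by (simp only: mult_ac)
    also have "\<dots> = (-1) ^ n * (Q ^ k * Q ^ (k choose 2) * (c k ^ m * Q ^ (m choose 2))) * (a ^ (2 * k) * (w / a ^ 3) ^ k) * Z"
      unfolding sgn wk by (simp only: mult_ac)
    also have "\<dots> = (-1) ^ n * a ^ (2 * n) * Q ^ (Suc n choose 2) * ((w / a ^ 3) ^ k * Z)"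
      unfolding pow an by (simp only: mult_ac)
    also have "(w / a ^ 3) ^ k * Z = poch (e n) k * poch g k * (w / a ^ 3) ^ k * ultra_factor a k
        / (poch Q k * (poch (b * Q) k)\<^sup>2 * poch (b * Q * X) k * poch (b * Q * Y) k)
      * phi22 (Q powi (int k - int n)) (b\<^sup>2 * Q ^ (n + k + 1)) (c k) (c k * X) q (Q * X)
      * phi22 (Q powi (int k - int n)) (b\<^sup>2 * Q ^ (n + k + 1)) (c k) (c k * Y) q (Q * Y)
      * ultra a y k"
      unfolding phi22_eq_jackson22 [OF k] gk Z_def J_def e_def m_def divide_inverse by (simp only: mult_ac)
    finally show "poch (e n) k * poch g k * Q ^ k * (-1) ^ k * Q ^ (k choose 2) * w ^ k * E k
       / ((poch (b * Q) k)\<^sup>2 * poch (b * Q * X) k * poch (b * Q * Y) k)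
       * product_sum (n - k) (e (n - k)) (g * Q ^ k) (c k) X Y =
       (-1) ^ n * a ^ (2 * n) * Q ^ (Suc n choose 2) *
      (poch (e n) k * poch g k * (w / a ^ 3) ^ k * ultra_factor a k
        / (poch Q k * (poch (b * Q) k)\<^sup>2 * poch (b * Q * X) k * poch (b * Q * Y) k)
      * phi22 (Q powi (int k - int n)) (b\<^sup>2 * Q ^ (n + k + 1)) (c k) (c k * X) q (Q * X)
      * phi22 (Q powi (int k - int n)) (b\<^sup>2 * Q ^ (n + k + 1)) (c k) (c k * Y) q (Q * Y)
      * ultra a y k)"
      unfolding m_def .
  qed
  finally show ?thesis
    unfolding sum_distrib_left [symmetric] e_def g_def c_def b4 [symmetric] b_def [symmetric] .
qed

lemma ultra_eq_aw_r:
  "ultra a (2 * cos \<theta>) k = aw_r k \<theta> a (- a) (a * rootQ) (- (a * rootQ)) q"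
proof -
  have 1: "a * - a * (a * rootQ) * - (a * rootQ) * Q powi (int k - 1) = a ^ 4 * Q ^ k"
  proof -
    have "a * - a * (a * rootQ) * - (a * rootQ) * Q powi (int k - 1) = a ^ 4 * (rootQ * rootQ * Q powi (int k - 1))"
      by (simp add: power4_eq_xxxx mult_ac)
    also have "rootQ * rootQ * Q powi (int k - 1) = Q ^ k"
      unfolding rootQ_square by (simp add: power_int_diff)
    finally show ?thesis .
  qed
  have 2: "a * - a = - a\<^sup>2" "a * (a * rootQ) = a\<^sup>2 * rootQ" "a * - (a * rootQ) = - (a\<^sup>2 * rootQ)"
    by (simp_all add: power2_eq_square)
  show ?thesis
    unfolding ultra_def aw_r_eq_sum 1 unfolding 2 by (simp add: mult_ac)
qed

lemma poch_duplication:
  "poch x k * poch (- x) k = (\<Prod>j<k. 1 - x\<^sup>2 * Q ^ (2 * j))"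
  unfolding qpoch_def prod.distrib [symmetric] power_double
  by (rule prod.cong) (auto simp: algebra_simps power2_eq_square)

text \<open>Translates the normalisation of r_k into that of p_k. For k > 0 the left side contains
  (a^4 q;q)_(2k-1): its odd powers of \<open>q\<close> give the two square-root factorials, and each
  even one splits as (1 - a^2 q^i) (1 + a^2 q^i).\<close>

lemma ultra_factor_eq:
  "ultra_factor a k * poch (a ^ 4 * Q ^ k) k =
    poch (a\<^sup>2 * Q) k * (poch (- a\<^sup>2) k * (poch (a\<^sup>2 * rootQ) k * poch (- (a\<^sup>2 * rootQ)) k))"
proof (cases k)
  case 0
  then show ?thesis by (simp add: ultra_factor_def)
next
  case (Suc r)
  define b where "b = a\<^sup>2"
  have b4: "a ^ 4 = b\<^sup>2"
    by (simp add: b_def)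
  have D: "poch (b * rootQ) k * poch (- (b * rootQ)) k = (\<Prod>j<k. 1 - b\<^sup>2 * Q * Q ^ (2 * j))" for k
    unfolding poch_duplication power_mult_distrib power2_eq_square [of rootQ] rootQ_square ..
  have key: "(1 + b) * (1 - b * Q ^ Suc r) * poch (b\<^sup>2 * Q) (Suc (2 * r)) =
     poch (b * Q) (Suc r) * (poch (- b) (Suc r) * (\<Prod>j<Suc r. 1 - b\<^sup>2 * Q * Q ^ (2 * j)))" for r
  proof (induction r)
    case 0
    show ?case by (simp add: qpoch_def mult_ac)
  next
    case (Suc r)
    have 1: "poch (b\<^sup>2 * Q) (Suc (2 * Suc r)) = poch (b\<^sup>2 * Q) (Suc (2 * r)) * ((1 - b\<^sup>2 * Q * Q ^ Suc (2 * r)) * (1 - b\<^sup>2 * Q * Q ^ (2 * Suc r)))"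
      by (simp add: qpoch_Suc mult_ac)
    have 2: "1 - b\<^sup>2 * Q * Q ^ Suc (2 * r) = (1 - b * Q ^ Suc r) * (1 + b * Q ^ Suc r)"
      unfolding power_Suc power_double by (simp add: algebra_simps power2_eq_square)
    have "(1 + b) * (1 - b * Q ^ Suc (Suc r)) * poch (b\<^sup>2 * Q) (Suc (2 * Suc r)) =
       ((1 + b) * (1 - b * Q ^ Suc r) * poch (b\<^sup>2 * Q) (Suc (2 * r))) * (1 - b * Q ^ Suc (Suc r)) * (1 + b * Q ^ Suc r) * (1 - b\<^sup>2 * Q * Q ^ (2 * Suc r))"
      unfolding 1 2 by (simp add: mult_ac)
    also have "\<dots> = poch (b * Q) (Suc (Suc r)) * (poch (- b) (Suc (Suc r)) * (\<Prod>j<Suc (Suc r). 1 - b\<^sup>2 * Q * Q ^ (2 * j)))"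
      unfolding Suc.IH prod.lessThan_Suc [of _ "Suc r"] qpoch_Suc [of _ _ "Suc r"] by (simp add: mult_ac)
    finally show ?case .
  qed
  have "poch (b\<^sup>2 * Q) (Suc (2 * r)) = poch (b\<^sup>2 * Q) r * poch (b\<^sup>2 * Q ^ Suc r) (Suc r)"
  proof -
    have "Suc (2 * r) = r + Suc r"
      by simp
    then show ?thesis
      by (simp only: qpoch_add power_Suc mult.assoc)
  qed
  then show ?thesis
    unfolding b4 b_def [symmetric] Suc D key [symmetric] ultra_factor_def
    by (simp add: mult_ac)
qed

section \<open>Specialisation to the parameters of the theorem\<close>

context
  fixes n :: nat and a s t \<theta> :: complex
  assumes a: "a \<noteq> 0" and s: "s \<noteq> 0" and t: "t \<noteq> 0"
begin

abbreviation "conn_phi k \<equiv>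
  phi22 (Q powi (int k - int n)) (a ^ 4 * Q ^ (n + k + 1)) (a\<^sup>2 * Q ^ (k + 1)) (- (a\<^sup>2 * s\<^sup>2 * Q ^ (k + 1))) q (- (s\<^sup>2 * Q))
  * phi22 (Q powi (int k - int n)) (a ^ 4 * Q ^ (n + k + 1)) (a\<^sup>2 * Q ^ (k + 1)) (- (a\<^sup>2 / t\<^sup>2 * Q ^ (k + 1))) q (- (Q / t\<^sup>2))"

lemma four_parameters:
  fixes A B C D
  defines "A \<equiv> a * s / t * rootQ" and "B \<equiv> a * t / s * rootQ"
    and "C \<equiv> - (a * s * t * rootQ)" and "D \<equiv> - (a / (s * t) * rootQ)"
  shows "A * B = a\<^sup>2 * Q" "A * C = - (a\<^sup>2 * s\<^sup>2 * Q)" "A * D = - (a\<^sup>2 / t\<^sup>2 * Q)"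
    "A * B * C * D * Q powi (int n - 1) = a ^ 4 * Q ^ (n + 1)"
proof -
  show AB: "A * B = a\<^sup>2 * Q" and "A * C = - (a\<^sup>2 * s\<^sup>2 * Q)" and "A * D = - (a\<^sup>2 / t\<^sup>2 * Q)"
    unfolding A_def B_def C_def D_def rootQ_square [symmetric] using s t
    by (simp_all add: power2_eq_square)
  have "C * D = a\<^sup>2 * Q"
    unfolding C_def D_def rootQ_square [symmetric] using s t
    by (simp add: power2_eq_square)
  then have "A * B * C * D = a ^ 4 * Q * Q"
    using AB by (simp add: power4_eq_xxxx power2_eq_square)
  then show "A * B * C * D * Q powi (int n - 1) = a ^ 4 * Q ^ (n + 1)"
    by (simp add: power_int_diff)
qed

text \<open>The common source of both identities. With \<open>ultra_factor\<close> in place of a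
  quotient by 1 - a^4 q^k it also covers a^2 = 1.\<close>

lemma aw_r_connection:
  assumes nz: "aw_nondeg n (a * s / t * rootQ) (a * t / s * rootQ) (- (a * s * t * rootQ)) (- (a / (s * t) * rootQ)) q"
    and nz': "aw_nondeg n a (- a) (a * rootQ) (- (a * rootQ)) q"
  shows "aw_r n \<theta> (a * s / t * rootQ) (a * t / s * rootQ) (- (a * s * t * rootQ)) (- (a / (s * t) * rootQ)) q =
    (-1) ^ n * a ^ (2 * n) * Q ^ (Suc n choose 2) *
    (\<Sum>k\<le>n. poch (Q powi (- int n)) k * poch (a ^ 4 * Q ^ (n + 1)) k * (s / (a\<^sup>2 * t) * rootQ) ^ k * ultra_factor a k
        / (poch Q k * (poch (a\<^sup>2 * Q) k)\<^sup>2 * poch (- (a\<^sup>2 * s\<^sup>2 * Q)) k * poch (- (a\<^sup>2 / t\<^sup>2 * Q)) k)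
      * conn_phi k * aw_r k \<theta> a (- a) (a * rootQ) (- (a * rootQ)) q)"
proof -
  define w X Y where "w = a * s / t * rootQ" and "X = - s\<^sup>2" and "Y = - 1 / t\<^sup>2"
  have XY: "- (a\<^sup>2 * s\<^sup>2 * z) = a\<^sup>2 * z * X" "- (a\<^sup>2 / t\<^sup>2 * z) = a\<^sup>2 * z * Y"
      "- (s\<^sup>2 * Q) = Q * X" "- (Q / t\<^sup>2) = Q * Y" for z
    by (simp_all add: X_def Y_def)
  have w: "w\<^sup>2 = a\<^sup>2 * Q * X * Y"
    unfolding w_def X_def Y_def rootQ_square [symmetric] using t by (simp add: power2_eq_square)
  have w3: "s / (a\<^sup>2 * t) * rootQ = w / a ^ 3"
    unfolding w_def using a by (simp add: power2_eq_square power3_eq_cube)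
  have nzs: "ultra_denom a n \<noteq> 0"
    using nz' unfolding aw_nondeg_def by (auto simp: qpochs_def power2_eq_square mult_ac)
  have nzs': "poch (a\<^sup>2 * Q) n \<noteq> 0" "poch (a\<^sup>2 * Q * X) n \<noteq> 0" "poch (a\<^sup>2 * Q * Y) n \<noteq> 0"
    using nz unfolding aw_nondeg_def four_parameters XY by (auto simp: qpochs_def)
  show ?thesis
    using aw_connection [OF a w nzs nzs', of "2 * cos \<theta>"]
    unfolding aw_r_eq_sum [of n] four_parameters(4)
    unfolding four_parameters(1-3) XY w3 ultra_eq_aw_r
    unfolding w_def [symmetric]
    by (simp only: mult.assoc)
qed

lemma aw_r_addition_formula:
  assumes "aw_nondeg n (a * s / t * rootQ) (a * t / s * rootQ) (- (a * s * t * rootQ)) (- (a / (s * t) * rootQ)) q"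
    and "aw_nondeg n a (- a) (a * rootQ) (- (a * rootQ)) q"
    and nz: "\<And>k. k \<le> n \<Longrightarrow> 1 - a ^ 4 * Q ^ k \<noteq> 0"
  shows "aw_r n \<theta> (a * s / t * rootQ) (a * t / s * rootQ) (- (a * s * t * rootQ)) (- (a / (s * t) * rootQ)) q =
    (-1) ^ n * a ^ (2 * n) * Q ^ (n * (n + 1) div 2) * (1 + a\<^sup>2) *
    (\<Sum>k\<le>n. (1 - a\<^sup>2 * Q ^ k) * qpochs [Q powi (- int n), a ^ 4 * Q, a ^ 4 * Q ^ (n + 1)] q k * (s / (a\<^sup>2 * t) * rootQ) ^ k
        / ((1 - a ^ 4 * Q ^ k) * poch Q k * (poch (a\<^sup>2 * Q) k)\<^sup>2 * poch (- (a\<^sup>2 * s\<^sup>2 * Q)) k * poch (- (a\<^sup>2 / t\<^sup>2 * Q)) k)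
      * conn_phi k * aw_r k \<theta> a (- a) (a * rootQ) (- (a * rootQ)) q)"
proof -
  have factor: "ultra_factor a k = (1 + a\<^sup>2) * ((1 - a\<^sup>2 * Q ^ k) * poch (a ^ 4 * Q) k * inverse (1 - a ^ 4 * Q ^ k))"
    if "k \<le> n" for k
  proof (cases k)
    case 0
    \<comment> \<open>At k = 0 the quotient reduces to 1, the separate value in
      \<open>ultra_factor\<close>.\<close>
    have "(1 + a\<^sup>2) * (1 - a\<^sup>2) = 1 - a ^ 4"
      by (simp add: algebra_simps power2_eq_square power4_eq_xxxx)
    then show ?thesis
      using nz [of 0] by (simp add: 0 ultra_factor_def mult.assoc [symmetric] del: mult.assoc)
  next
    case (Suc r)
    have "poch (a ^ 4 * Q) k = poch (a ^ 4 * Q) r * (1 - a ^ 4 * Q ^ k)"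
      by (simp add: Suc qpoch_Suc mult_ac)
    then show ?thesis
      using nz [OF that] by (simp add: Suc ultra_factor_def)
  qed
  have c2: "Suc n choose 2 = n * (n + 1) div 2"
    by (simp add: choose_two mult.commute)
  show ?thesis
    unfolding aw_r_connection [OF assms(1,2)] c2 mult.assoc [of _ "1 + a\<^sup>2"] sum_distrib_left [of "1 + a\<^sup>2"]
  proof (intro arg_cong [where f = "\<lambda>x. _ * x"] sum.cong [OF refl])
    fix k assume "k \<in> {..n}"
    then have k: "k \<le> n" by simp
    show "poch (Q powi (- int n)) k * poch (a ^ 4 * Q ^ (n + 1)) k * (s / (a\<^sup>2 * t) * rootQ) ^ k * ultra_factor a k
        / (poch Q k * (poch (a\<^sup>2 * Q) k)\<^sup>2 * poch (- (a\<^sup>2 * s\<^sup>2 * Q)) k * poch (- (a\<^sup>2 / t\<^sup>2 * Q)) k)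
      * conn_phi k * aw_r k \<theta> a (- a) (a * rootQ) (- (a * rootQ)) q =
     (1 + a\<^sup>2) * ((1 - a\<^sup>2 * Q ^ k) * qpochs [Q powi (- int n), a ^ 4 * Q, a ^ 4 * Q ^ (n + 1)] q k * (s / (a\<^sup>2 * t) * rootQ) ^ k
        / ((1 - a ^ 4 * Q ^ k) * poch Q k * (poch (a\<^sup>2 * Q) k)\<^sup>2 * poch (- (a\<^sup>2 * s\<^sup>2 * Q)) k * poch (- (a\<^sup>2 / t\<^sup>2 * Q)) k)
      * conn_phi k * aw_r k \<theta> a (- a) (a * rootQ) (- (a * rootQ)) q)"
      unfolding factor [OF k] qpochs_def list.map prod_list.Cons prod_list.Nil divide_inverse inverse_mult_distrib
      by (simp only: mult_ac mult_1_right mult_1_left)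
  qed
qed

text \<open>The prefactor of p_n multiplies \<open>aw_r_connection\<close>. Each shifted factorial
  of length \<open>n\<close> splits into lengths \<open>k\<close> and n - k, and
  \<open>ultra_factor_eq\<close> supplies the prefactor of p_k.\<close>

lemma aw_p_addition_formula:
  assumes nz: "aw_nondeg n (a * s / t * rootQ) (a * t / s * rootQ) (- (a * s * t * rootQ)) (- (a / (s * t) * rootQ)) q"
    and nz': "aw_nondeg n a (- a) (a * rootQ) (- (a * rootQ)) q"
    and nz4: "\<And>k. k \<le> n \<Longrightarrow> poch (a ^ 4 * Q ^ k) k \<noteq> 0"
  shows "aw_p n \<theta> (a * s / t * rootQ) (a * t / s * rootQ) (- (a * s * t * rootQ)) (- (a / (s * t) * rootQ)) q =
    (-1) ^ n * rootQ ^ (n\<^sup>2) *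
    (\<Sum>k\<le>n. a ^ (n - k) * poch (a\<^sup>2 * Q ^ (k + 1)) (n - k) * rootQ ^ k
       * qpochs [Q powi (- int n), a ^ 4 * Q ^ (n + 1)] q k / qpochs [Q, a ^ 4 * Q ^ k] q k
       * qpochs [- (a\<^sup>2 * s\<^sup>2 * Q ^ (k + 1)), - (a\<^sup>2 / t\<^sup>2 * Q ^ (k + 1))] q (n - k) / (s / t) ^ (n - k)
       * conn_phi k * aw_p k \<theta> a (- a) (a * rootQ) (- (a * rootQ)) q)"
proof -
  define u where "u = s / t"
  have u: "u \<noteq> 0"
    using s t by (simp add: u_def)
  define A where "A = a * s / t * rootQ"
  have A: "A = u * a * rootQ"
    by (simp add: A_def u_def)
  have A_power: "A powi (- int n) = inverse (A ^ n)"
    by (simp add: power_int_minus)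
  define P where "P = poch (a\<^sup>2 * Q) n * (poch (- (a\<^sup>2 * s\<^sup>2 * Q)) n * poch (- (a\<^sup>2 / t\<^sup>2 * Q)) n)"
  have P: "poch (a\<^sup>2 * Q) n \<noteq> 0" "poch (- (a\<^sup>2 * s\<^sup>2 * Q)) n \<noteq> 0" "poch (- (a\<^sup>2 / t\<^sup>2 * Q)) n \<noteq> 0"
    using nz unfolding aw_nondeg_def four_parameters by (auto simp: qpochs_def)
  have p: "aw_p k \<theta> a (- a) (a * rootQ) (- (a * rootQ)) q = inverse (a ^ k) *
      (poch (- a\<^sup>2) k * (poch (a\<^sup>2 * rootQ) k * poch (- (a\<^sup>2 * rootQ)) k)) * aw_r k \<theta> a (- a) (a * rootQ) (- (a * rootQ)) q" for k
  proof -
    have "a * - a = - a\<^sup>2" "a * (a * rootQ) = a\<^sup>2 * rootQ" "a * - (a * rootQ) = - (a\<^sup>2 * rootQ)"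
      by (simp_all add: power2_eq_square)
    then show ?thesis
      unfolding aw_p_def qpochs_def list.map prod_list.Cons prod_list.Nil power_int_minus power_int_of_nat
      by (simp only: mult_1_right)
  qed
  have "aw_p n \<theta> (a * s / t * rootQ) (a * t / s * rootQ) (- (a * s * t * rootQ)) (- (a / (s * t) * rootQ)) q =
      inverse (A ^ n) * P * ((-1) ^ n * a ^ (2 * n) * Q ^ (Suc n choose 2) *
    (\<Sum>k\<le>n. poch (Q powi (- int n)) k * poch (a ^ 4 * Q ^ (n + 1)) k * (s / (a\<^sup>2 * t) * rootQ) ^ k * ultra_factor a k
        / (poch Q k * (poch (a\<^sup>2 * Q) k)\<^sup>2 * poch (- (a\<^sup>2 * s\<^sup>2 * Q)) k * poch (- (a\<^sup>2 / t\<^sup>2 * Q)) k)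
      * conn_phi k * aw_r k \<theta> a (- a) (a * rootQ) (- (a * rootQ)) q))"
    unfolding aw_p_def four_parameters(1-3) aw_r_connection [OF nz nz'] qpochs_def P_def
      list.map prod_list.Cons prod_list.Nil mult_1_right
    unfolding A_def [symmetric] A_power ..
  also have "\<dots> = (-1) ^ n * (\<Sum>k\<le>n. inverse (A ^ n) * P * (a ^ (2 * n) * Q ^ (Suc n choose 2) *
    (poch (Q powi (- int n)) k * poch (a ^ 4 * Q ^ (n + 1)) k * (s / (a\<^sup>2 * t) * rootQ) ^ k * ultra_factor a k
        / (poch Q k * (poch (a\<^sup>2 * Q) k)\<^sup>2 * poch (- (a\<^sup>2 * s\<^sup>2 * Q)) k * poch (- (a\<^sup>2 / t\<^sup>2 * Q)) k)
      * conn_phi k * aw_r k \<theta> a (- a) (a * rootQ) (- (a * rootQ)) q)))"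
    unfolding sum_distrib_left by (rule sum.cong [OF refl]) (simp only: mult_ac)
  also have "\<dots> = (-1) ^ n * (\<Sum>k\<le>n. rootQ ^ (n\<^sup>2) * (a ^ (n - k) * poch (a\<^sup>2 * Q ^ (k + 1)) (n - k) * rootQ ^ k
       * qpochs [Q powi (- int n), a ^ 4 * Q ^ (n + 1)] q k / qpochs [Q, a ^ 4 * Q ^ k] q k
       * qpochs [- (a\<^sup>2 * s\<^sup>2 * Q ^ (k + 1)), - (a\<^sup>2 / t\<^sup>2 * Q ^ (k + 1))] q (n - k) / (s / t) ^ (n - k)
       * conn_phi k * aw_p k \<theta> a (- a) (a * rootQ) (- (a * rootQ)) q))"
  proof (intro arg_cong [where f = "\<lambda>x. _ * x"] sum.cong [OF refl])
    fix k assume "k \<in> {..n}"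
    then have k: "k \<le> n" by simp
    define m where "m = n - k"
    have n: "n = k + m"
      using k by (simp add: m_def)
    have split: "poch (x * Q) n = poch (x * Q) k * poch (x * Q ^ (k + 1)) m" for x
      unfolding n qpoch_add by (simp add: mult_ac)
    have split': "poch (- (x * Q)) n = poch (- (x * Q)) k * poch (- (x * Q ^ (k + 1))) m" for x
      using split [of "- x"] by simp
    define p1 p2 p3 where "p1 = poch (a\<^sup>2 * Q) k" and "p2 = poch (- (a\<^sup>2 * s\<^sup>2 * Q)) k" and "p3 = poch (- (a\<^sup>2 / t\<^sup>2 * Q)) k"
    define r1 r2 r3 where "r1 = poch (a\<^sup>2 * Q ^ (k + 1)) m" and "r2 = poch (- (a\<^sup>2 * s\<^sup>2 * Q ^ (k + 1))) m"
      and "r3 = poch (- (a\<^sup>2 / t\<^sup>2 * Q ^ (k + 1))) m"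
    have P': "P = (p1 * r1) * ((p2 * r2) * (p3 * r3))"
      unfolding P_def p1_def p2_def p3_def r1_def r2_def r3_def split split' ..
    have pnz: "p1 \<noteq> 0" "p2 \<noteq> 0" "p3 \<noteq> 0"
      using P unfolding p1_def p2_def p3_def split split' by auto
    define F where "F = poch (- a\<^sup>2) k * (poch (a\<^sup>2 * rootQ) k * poch (- (a\<^sup>2 * rootQ)) k)"
    define h where "h = poch (a ^ 4 * Q ^ k) k"
    have h: "h \<noteq> 0"
      unfolding h_def using nz4 [OF k] .
    have factor: "ultra_factor a k = p1 * F / h"
      using ultra_factor_eq [of a k] h unfolding F_def h_def p1_def by (simp add: divide_simps)
    \<comment> \<open>From q^(n(n+1)/2) = q^(n^2/2) q^(n/2), the last factor cancels against the one
      in A^(-n).\<close>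
    have scalar: "inverse (A ^ n) * a ^ (2 * n) * Q ^ (Suc n choose 2) * (s / (a\<^sup>2 * t) * rootQ) ^ k =
        rootQ ^ (n\<^sup>2) * a ^ m * rootQ ^ k / u ^ m * inverse (a ^ k)"
    proof -
      have "Q ^ (Suc n choose 2) = rootQ ^ (2 * (Suc n choose 2))"
        unfolding power_double rootQ_square [symmetric] power_mult_distrib ..
      also have "2 * (Suc n choose 2) = n\<^sup>2 + n"
        using double_choose_2 [of "Suc n"] by (simp add: power2_eq_square)
      finally have 1: "Q ^ (Suc n choose 2) = rootQ ^ (n\<^sup>2) * rootQ ^ n"
        by (simp only: power_add)
      have 2: "s / (a\<^sup>2 * t) * rootQ = u / a\<^sup>2 * rootQ"
        by (simp add: u_def)
      have 3: "inverse (A ^ n) * rootQ ^ n = inverse (u ^ n * a ^ n)"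
        unfolding A power_mult_distrib by simp
      have "inverse (A ^ n) * a ^ (2 * n) * Q ^ (Suc n choose 2) * (s / (a\<^sup>2 * t) * rootQ) ^ k =
          (inverse (A ^ n) * rootQ ^ n) * (a ^ n * a ^ n) * rootQ ^ (n\<^sup>2) * (u / a\<^sup>2 * rootQ) ^ k"
        unfolding 1 2 power_double by (simp only: mult_ac)
      also have "\<dots> = inverse (u ^ n) * a ^ n * rootQ ^ (n\<^sup>2) * (u ^ k / (a ^ k * a ^ k) * rootQ ^ k)"
        unfolding 3 power_mult_distrib power_divide power2_eq_square using a by simp
      also have "\<dots> = rootQ ^ (n\<^sup>2) * a ^ m * rootQ ^ k / u ^ m * inverse (a ^ k)"
      proof -
        define N where "N = n\<^sup>2"
        have un: "u ^ n = u ^ k * u ^ m" and an: "a ^ n = a ^ k * a ^ m"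
          by (simp_all add: n power_add)
        show ?thesis
          unfolding N_def [symmetric] un an using u a by (simp add: divide_simps)
      qed
      finally show ?thesis .
    qed
    define R where "R = aw_r k \<theta> a (- a) (a * rootQ) (- (a * rootQ)) q"
    define L where "L = poch (Q powi (- int n)) k * poch (a ^ 4 * Q ^ (n + 1)) k"
    define z where "z = poch Q k"
    define \<Phi> where "\<Phi> = conn_phi k"
    \<comment> \<open>The squared (a^2 q;q)_k is cancelled by one factor from \<open>P\<close> and
      one from \<open>ultra_factor\<close>.\<close>
    have cancel: "p1 * r1 * (p2 * r2 * (p3 * r3)) * (p1 * F / h / (z * p1\<^sup>2 * p2 * p3)) = r1 * F / (z * h) * (r2 * r3)"
      using pnz by (simp add: power2_eq_square mult_ac)
    have "inverse (A ^ n) * P * (a ^ (2 * n) * Q ^ (Suc n choose 2) *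
      (L * (s / (a\<^sup>2 * t) * rootQ) ^ k * ultra_factor a k / (z * p1\<^sup>2 * p2 * p3) * \<Phi> * R)) =
      (inverse (A ^ n) * a ^ (2 * n) * Q ^ (Suc n choose 2) * (s / (a\<^sup>2 * t) * rootQ) ^ k)
       * (p1 * r1 * (p2 * r2 * (p3 * r3)) * (p1 * F / h / (z * p1\<^sup>2 * p2 * p3))) * (L * \<Phi> * R)"
      unfolding P' factor divide_inverse by (simp only: mult_ac)
    also have "\<dots> = rootQ ^ (n\<^sup>2) * (a ^ m * r1 * rootQ ^ k * L / (z * h) * (r2 * r3) / u ^ m * \<Phi> * (inverse (a ^ k) * F * R))"
      unfolding scalar cancel unfolding divide_inverse inverse_mult_distrib by (simp only: mult_ac)
    finally have "inverse (A ^ n) * P * (a ^ (2 * n) * Q ^ (Suc n choose 2) *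
      (L * (s / (a\<^sup>2 * t) * rootQ) ^ k * ultra_factor a k / (z * p1\<^sup>2 * p2 * p3) * \<Phi> * R)) =
      rootQ ^ (n\<^sup>2) * (a ^ m * r1 * rootQ ^ k * L / (z * h) * (r2 * r3) / u ^ m * \<Phi> * (inverse (a ^ k) * F * R))" .
    then show "inverse (A ^ n) * P * (a ^ (2 * n) * Q ^ (Suc n choose 2) *
      (poch (Q powi (- int n)) k * poch (a ^ 4 * Q ^ (n + 1)) k * (s / (a\<^sup>2 * t) * rootQ) ^ k * ultra_factor a k
        / (poch Q k * (poch (a\<^sup>2 * Q) k)\<^sup>2 * poch (- (a\<^sup>2 * s\<^sup>2 * Q)) k * poch (- (a\<^sup>2 / t\<^sup>2 * Q)) k)
      * conn_phi k * aw_r k \<theta> a (- a) (a * rootQ) (- (a * rootQ)) q)) =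
      rootQ ^ (n\<^sup>2) * (a ^ (n - k) * poch (a\<^sup>2 * Q ^ (k + 1)) (n - k) * rootQ ^ k
       * qpochs [Q powi (- int n), a ^ 4 * Q ^ (n + 1)] q k / qpochs [Q, a ^ 4 * Q ^ k] q k
       * qpochs [- (a\<^sup>2 * s\<^sup>2 * Q ^ (k + 1)), - (a\<^sup>2 / t\<^sup>2 * Q ^ (k + 1))] q (n - k) / (s / t) ^ (n - k)
       * conn_phi k * aw_p k \<theta> a (- a) (a * rootQ) (- (a * rootQ)) q)"
      unfolding p qpochs_def list.map prod_list.Cons prod_list.Nil mult_1_right
        L_def R_def z_def \<Phi>_def p1_def p2_def p3_def r1_def r2_def r3_def F_def h_def u_def m_def .
  qed
  finally show ?thesis
    by (simp only: sum_distrib_left mult.assoc)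
qed

end
end

theorem theorem1p1:
  fixes q :: real and n :: nat and \<theta> a s t :: complex
  assumes "0 < q" and "q < 1" and "a \<noteq> 0" and "s \<noteq> 0" and "t \<noteq> 0"
  shows
    "(aw_nondeg n (a * s / t * of_real (sqrt q)) (a * t / s * of_real (sqrt q))
           (- (a * s * t * of_real (sqrt q))) (- (a / (s * t) * of_real (sqrt q))) q \<and>
       (\<forall>k\<le>n. ((1 - a^4 * of_real q ^ k) * qpoch (of_real q) q k * (qpoch (a^2 * of_real q) q k)^2
              * qpoch (- (a^2 * s^2 * of_real q)) q k * qpoch (- (a^2 / t^2 * of_real q)) q k) \<noteq> 0 \<and>
            phi22_nondeg (n - k) (a^2 * of_real q ^ (k + 1)) (- (a^2 * s^2 * of_real q ^ (k + 1))) q \<and>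
            phi22_nondeg (n - k) (a^2 * of_real q ^ (k + 1)) (- (a^2 / t^2 * of_real q ^ (k + 1))) q \<and>
            aw_nondeg k a (- a) (a * of_real (sqrt q)) (- (a * of_real (sqrt q))) q)
      \<longrightarrow>
      aw_r n \<theta> (a * s / t * of_real (sqrt q)) (a * t / s * of_real (sqrt q))
           (- (a * s * t * of_real (sqrt q))) (- (a / (s * t) * of_real (sqrt q))) q =
       (-1) ^ n * a ^ (2 * n) * of_real q ^ (n * (n + 1) div 2) * (1 + a^2) *
       (\<Sum>k\<le>n.
           (1 - a^2 * of_real q ^ k)
           * qpochs [of_real q powi (- int n), a^4 * of_real q, a^4 * of_real q ^ (n + 1)] q k
           * (s / (a^2 * t) * of_real (sqrt q)) ^ k
           / ((1 - a^4 * of_real q ^ k) * qpoch (of_real q) q k * (qpoch (a^2 * of_real q) q k)^2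
              * qpoch (- (a^2 * s^2 * of_real q)) q k * qpoch (- (a^2 / t^2 * of_real q)) q k)
           * phi22 (of_real q powi (int k - int n)) (a^4 * of_real q ^ (n + k + 1))
                   (a^2 * of_real q ^ (k + 1)) (- (a^2 * s^2 * of_real q ^ (k + 1))) q (- (s^2 * of_real q))
           * phi22 (of_real q powi (int k - int n)) (a^4 * of_real q ^ (n + k + 1))
                   (a^2 * of_real q ^ (k + 1)) (- (a^2 / t^2 * of_real q ^ (k + 1))) q (- (of_real q / t^2))
           * aw_r k \<theta> a (- a) (a * of_real (sqrt q)) (- (a * of_real (sqrt q))) q))
     \<and>
     (aw_nondeg n (a * s / t * of_real (sqrt q)) (a * t / s * of_real (sqrt q))
           (- (a * s * t * of_real (sqrt q))) (- (a / (s * t) * of_real (sqrt q))) q \<and>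
       (\<forall>k\<le>n. qpochs [of_real q, a^4 * of_real q ^ k] q k \<noteq> 0 \<and>
            phi22_nondeg (n - k) (a^2 * of_real q ^ (k + 1)) (- (a^2 * s^2 * of_real q ^ (k + 1))) q \<and>
            phi22_nondeg (n - k) (a^2 * of_real q ^ (k + 1)) (- (a^2 / t^2 * of_real q ^ (k + 1))) q \<and>
            aw_nondeg k a (- a) (a * of_real (sqrt q)) (- (a * of_real (sqrt q))) q)
      \<longrightarrow>
      aw_p n \<theta> (a * s / t * of_real (sqrt q)) (a * t / s * of_real (sqrt q))
           (- (a * s * t * of_real (sqrt q))) (- (a / (s * t) * of_real (sqrt q))) q =
       (-1) ^ n * of_real (sqrt q) ^ (n^2) *
       (\<Sum>k\<le>n.
           a ^ (n - k) * qpoch (a^2 * of_real q ^ (k + 1)) q (n - k) * of_real (sqrt q) ^ k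
           * qpochs [of_real q powi (- int n), a^4 * of_real q ^ (n + 1)] q k
           / qpochs [of_real q, a^4 * of_real q ^ k] q k
           * qpochs [- (a^2 * s^2 * of_real q ^ (k + 1)), - (a^2 / t^2 * of_real q ^ (k + 1))] q (n - k)
           / (s / t) ^ (n - k)
           * phi22 (of_real q powi (int k - int n)) (a^4 * of_real q ^ (n + k + 1))
                   (a^2 * of_real q ^ (k + 1)) (- (a^2 * s^2 * of_real q ^ (k + 1))) q (- (s^2 * of_real q))
           * phi22 (of_real q powi (int k - int n)) (a^4 * of_real q ^ (n + k + 1))
                   (a^2 * of_real q ^ (k + 1)) (- (a^2 / t^2 * of_real q ^ (k + 1))) q (- (of_real q / t^2))
           * aw_p k \<theta> a (- a) (a * of_real (sqrt q)) (- (a * of_real (sqrt q))) q))"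
proof -
  interpret q_base q
    using assms by unfold_locales
  show ?thesis
  proof ((intro conjI impI; elim conjE), goal_cases)
    case 1
    \<comment> \<open>The first fact is the instance k = n of the condition on the r_k.\<close>
    then have "aw_nondeg n a (- a) (a * rootQ) (- (a * rootQ)) q" "\<And>k. k \<le> n \<Longrightarrow> 1 - a ^ 4 * Q ^ k \<noteq> 0"
      by auto
    from aw_r_addition_formula [OF assms(3-5) 1(1) this, of \<theta>] show ?case
      by (simp only: mult.assoc)
  next
    case 2
    then have "aw_nondeg n a (- a) (a * rootQ) (- (a * rootQ)) q" "\<And>k. k \<le> n \<Longrightarrow> poch (a ^ 4 * Q ^ k) k \<noteq> 0"
      by (auto simp: qpochs_def)
    from aw_p_addition_formula [OF assms(3-5) 2(1) this, of \<theta>] show ?case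
      by (simp only: mult.assoc)
  qed
qed

end
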